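(* Let $\chi_1$ and $\chi_2$ be nontrivial primitive Dirichlet characters modulo $q_1$ and $q_2$, respectively, such that $\chi_1\chi_2(-1)=1$, and let $c$ be a positive integer with $q_1q_2\mid c$. Then \[ \sum_{\substack{a \bmod c \\ (a,c)=1}} \lvert S_{\chi_1,\chi_2}(a,c)\rvert^2 =\frac{\varphi(c)}{\pi^4}\sum_{\substack{\psi \bmod c\\ \psi\chi_1(-1)=-1}} \lvert L(1,\overline{\psi}^{\star}\chi_1)\rvert^2\,\lvert L(1,(\psi\chi_2)^\star)\rvert^2\,\lvert g_{\chi_1,\chi_2}(\psi;c)\rvert^2, \] where the sum runs over Dirichlet characters $\psi$ modulo $c$ and \[ g_{\chi_1,\chi_2}(\psi;c)=\tau\big((\overline{\psi\chi_2})^\star\big)\,\tau(\psi^\star)\,\tau(\overline{\chi_1})\sum_{\substack{d\mid c\\ q(\psi)\mid d}}\frac{\overline{\chi_2}(c/d)}{\varphi(d)}\Big(\sum_{k\mid d}\mu(k)(\overline{\psi\chi_2})^\star(k)\Big)\Big(\sum_{k\mid d/q(\psi)}\chi_1(k)\,\mu\!\Big(\frac{d}{kq(\psi)}\Big)\psi^\star\!\Big(\frac{d}{kq(\psi)}\Big)\Big). \]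
   Context: Dirichlet characters are extended by $0$ to integers not coprime to their modulus. $B_1(x)=0$ if $x\in\mathbb{Z}$ and $B_1(x)=x-\lfloor x\rfloor-\tfrac12$ otherwise. For integers $a$ and $c\ge1$ with $q_1q_2\mid c$, the generalized Dedekind sum is \[S_{\chi_1,\chi_2}(a,c)=\sum_{j\bmod c}\sum_{n\bmod q_1}\overline{\chi_2}(j)\overline{\chi_1}(n)B_1\!\Big(\frac{j}{c}\Big)B_1\!\Big(\frac{n}{q_1}+\frac{aj}{c}\Big).\] For a character $\chi$, $\chi^\star$ denotes the primitive character inducing $\chi$ and $q(\chi)$ its conductor (the modulus of $\chi^\star$). For a character $\chi$ modulo $q$, $e(x)=\exp(2\pi i x)$ and $\tau(\chi)=\sum_{n\bmod q}\chi(n)e(n/q)$ is the Gauss sum (for $\chi^\star$ it is taken modulo $q(\chi)$). $\overline{\psi}^\star\chi_1$ denotes the character $n\mapsto\overline{\psi^\star}(n)\chi_1(n)$, $(\psi\chi_2)^\star$ is the primitive character inducing $n\mapsto\psi(n)\chi_2(n)$, and $(\overline{\psi\chi_2})^\star$ is its complex conjugate. $L(1,\chi)=\sum_{n\ge1}\chi(n)/n$, $\mu$ is the Möbius function and $\varphi$ Euler's function. *)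

theory Defs
  imports "HOL-Analysis.Analysis" "HOL-Number_Theory.Number_Theory"
    "HOL-Computational_Algebra.Squarefree"
begin

section \<open>Dirichlet characters\<close>

text \<open>
  A character is a function on all integers, extended by 0. Such a function determines its modulus
  only up to the set of prime factors, so the modulus is always passed separately.
\<close>

definition dirichlet_character :: "nat \<Rightarrow> (int \<Rightarrow> complex) \<Rightarrow> bool" where
  "dirichlet_character q chi \<longleftrightarrow>
     q > 0 \<and>
     (\<forall>m n. chi (m * n) = chi m * chi n) \<and>
     (\<forall>n. chi (n + int q) = chi n) \<and>
     (\<forall>n. chi n \<noteq> 0 \<longleftrightarrow> coprime n (int q))"

definition principal_character :: "nat \<Rightarrow> int \<Rightarrow> complex" where
  "principal_character q n = (if coprime n (int q) then 1 else 0)"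

definition induced_from :: "nat \<Rightarrow> (int \<Rightarrow> complex) \<Rightarrow> nat \<Rightarrow> (int \<Rightarrow> complex) \<Rightarrow> bool" where
  "induced_from q chi d chi' \<longleftrightarrow>
     d dvd q \<and> dirichlet_character d chi' \<and> (\<forall>n. coprime n (int q) \<longrightarrow> chi n = chi' n)"

definition primitive_character :: "nat \<Rightarrow> (int \<Rightarrow> complex) \<Rightarrow> bool" where
  "primitive_character q chi \<longleftrightarrow>
     dirichlet_character q chi \<and> (\<forall>d chi'. induced_from q chi d chi' \<longrightarrow> d = q)"

text \<open>
  For a character \<open>chi\<close> modulo \<open>q\<close>, \<open>conductor q chi\<close> is \<open>q(chi)\<close> and \<open>prim_char q chi\<close> is \<open>chi\<^sup>\<star>\<close>.
  Both descriptions are proper: see \<open>unique_primitive_inducing\<close> below.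
\<close>

definition conductor :: "nat \<Rightarrow> (int \<Rightarrow> complex) \<Rightarrow> nat" where
  "conductor q chi = (THE d. \<exists>chi'. primitive_character d chi' \<and> induced_from q chi d chi')"

definition prim_char :: "nat \<Rightarrow> (int \<Rightarrow> complex) \<Rightarrow> int \<Rightarrow> complex" where
  "prim_char q chi =
     (THE chi'. \<exists>d. primitive_character d chi' \<and> induced_from q chi d chi')"

definition gauss_sum :: "nat \<Rightarrow> (int \<Rightarrow> complex) \<Rightarrow> complex" where
  "gauss_sum q chi =
     (\<Sum>n\<in>{0..<int q}. chi n * exp (2 * of_real pi * \<i> * (of_int n / of_nat q)))"

text \<open>The series converges only conditionally, so the order of summation in \<open>suminf\<close> matters.\<close>

definition L_one :: "(int \<Rightarrow> complex) \<Rightarrow> complex" where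
  "L_one chi = (\<Sum>n. chi (int (Suc n)) / of_nat (Suc n))"

definition moebius_mu :: "nat \<Rightarrow> int" where
  "moebius_mu n = (if squarefree n then (-1) ^ card (prime_factors n) else 0)"

section \<open>Generalized Dedekind sums\<close>

definition B1 :: "real \<Rightarrow> real" where
  "B1 x = (if x \<in> \<int> then 0 else x - of_int \<lfloor>x\<rfloor> - 1 / 2)"

text \<open>The modulus of \<open>chi2\<close> enters only through the standing assumption \<open>q1 * q2 dvd c\<close>.\<close>

definition dedekind_sum ::
    "nat \<Rightarrow> (int \<Rightarrow> complex) \<Rightarrow> (int \<Rightarrow> complex) \<Rightarrow> int \<Rightarrow> nat \<Rightarrow> complex" where
  "dedekind_sum q1 chi1 chi2 a c =
     (\<Sum>j\<in>{0..<int c}. \<Sum>n\<in>{0..<int q1}.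
        cnj (chi2 j) * cnj (chi1 n) *
        of_real (B1 (of_int j / of_nat c)) *
        of_real (B1 (of_int n / of_nat q1 + of_int (a * j) / of_nat c)))"

text \<open>
  Here \<open>\<psi>\<close> has modulus \<open>c\<close>, and so has \<open>\<psi>chi2\<close> since \<open>q2 dvd c\<close>.
\<close>

definition g_factor ::
    "nat \<Rightarrow> (int \<Rightarrow> complex) \<Rightarrow> (int \<Rightarrow> complex) \<Rightarrow> (int \<Rightarrow> complex) \<Rightarrow> nat \<Rightarrow> complex" where
  "g_factor q1 chi1 chi2 \<psi> c =
     (let \<psi>' = prim_char c \<psi>;
          q\<psi> = conductor c \<psi>;
          \<theta> = (\<lambda>n. \<psi> n * chi2 n);
          \<theta>' = (\<lambda>n. cnj (prim_char c \<theta> n))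
      in gauss_sum (conductor c \<theta>) \<theta>' * gauss_sum q\<psi> \<psi>' * gauss_sum q1 (\<lambda>n. cnj (chi1 n)) *
         (\<Sum>d | d dvd c \<and> q\<psi> dvd d.
            cnj (chi2 (int (c div d))) / of_nat (totient d) *
            (\<Sum>k | k dvd d. of_int (moebius_mu k) * \<theta>' (int k)) *
            (\<Sum>k | k dvd d div q\<psi>.
               chi1 (int k) * of_int (moebius_mu (d div (k * q\<psi>))) * \<psi>' (int (d div (k * q\<psi>))))))"

section \<open>Well-definedness\<close>

lemma dirichlet_character_cong:
  assumes "dirichlet_character q chi" "[m = n] (mod int q)"
  shows "chi m = chi n"
proof -
  have per: "chi (x + int k * int q) = chi x" for x k
  proof (induction k)
    case (Suc k)
    have "chi (x + int (Suc k) * int q) = chi ((x + int k * int q) + int q)"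
      by (simp add: algebra_simps)
    also have "\<dots> = chi (x + int k * int q)"
      using assms(1) by (simp only: dirichlet_character_def)
    finally show ?case using Suc by simp
  qed simp
  obtain k where k: "m = n + k * int q"
    using assms(2) by (metis cong_iff_lin cong_sym mult.commute)
  show ?thesis
  proof (cases "k \<ge> 0")
    case True
    then show ?thesis using per[of n "nat k"] k by simp
  next
    case False
    then have "m + int (nat (- k)) * int q = n" using k by simp
    then show ?thesis using per[of m "nat (- k)"] by simp
  qed
qed

lemma exists_coprime_lift:
  fixes x :: int
  assumes "q > 0" "d dvd q" "coprime x (int d)"
  shows "\<exists>y. [y = x] (mod int d) \<and> coprime y (int q)"
proof -
  define P where "P = {p \<in> prime_factors (int q). \<not> p dvd x}"
  define t where "t = \<Prod>P"
  have fin: "finite P" by (simp add: P_def)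
  have "coprime (x + int d * t) (int q)"
  proof (rule ccontr)
    assume "\<not> coprime (x + int d * t) (int q)"
    then obtain p :: int where p: "prime p" "p dvd x + int d * t" "p dvd int q"
    proof -
      assume *: "\<And>p. prime p \<Longrightarrow> p dvd x + int d * t \<Longrightarrow> p dvd int q \<Longrightarrow> thesis"
      obtain r where r: "r dvd x + int d * t" "r dvd int q" "\<not> is_unit r"
        using \<open>\<not> coprime (x + int d * t) (int q)\<close> by (rule not_coprimeE)
      have "r \<noteq> 0" using r(2) assms(1) by auto
      then obtain p where "prime p" "p dvd r" using r(3) prime_divisor_exists by blast
      then show thesis using * r(1,2) dvd_trans by blast
    qed
    have pq: "p \<in> prime_factors (int q)" using p assms(1) by (simp add: in_prime_factors_iff)
    show False
    proof (cases "p dvd x")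
      case True
      then have "p dvd int d * t" using p(2) by (simp add: dvd_add_right_iff)
      moreover have "\<not> p dvd int d"
        using True assms(3) p(1) by (meson coprime_common_divisor not_prime_unit)
      ultimately have "p dvd t" using p(1) by (simp add: prime_dvd_mult_iff)
      then obtain r where r: "r \<in> P" "p dvd r"
        using p(1) fin unfolding t_def by (auto simp: prime_dvd_prod_iff)
      then have "p = r" using p(1) by (auto simp: P_def intro: primes_dvd_imp_eq)
      then show False using r True by (simp add: P_def)
    next
      case False
      then have "p \<in> P" using pq by (simp add: P_def)
      then have "p dvd int d * t" using fin dvd_prodI[of P p "\<lambda>x. x"] by (simp add: t_def)
      then show False using False p(2) by (simp add: dvd_add_left_iff)
    qed
  qed
  then show ?thesis by (intro exI[of _ "x + int d * t"]) (simp add: cong_def)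
qed

lemma induced_from_trans:
  assumes "induced_from q chi d chi'" "induced_from d chi' e chi''"
  shows "induced_from q chi e chi''"
proof -
  have "coprime n (int d)" if "coprime n (int q)" for n
    using coprime_divisors[OF dvd_refl _ that, of "int d"] assms(1) by (simp add: induced_from_def)
  then show ?thesis using assms by (auto simp: induced_from_def intro: dvd_trans)
qed

lemma induced_from_refl: "dirichlet_character q chi \<Longrightarrow> induced_from q chi q chi"
  by (simp add: induced_from_def)

lemma induced_from_unique:
  assumes "q > 0" "induced_from q chi d chi'" "induced_from q chi d chi''"
  shows "chi' = chi''"
proof
  fix n
  have D: "dirichlet_character d chi'" "dirichlet_character d chi''" "d dvd q"
    using assms by (auto simp: induced_from_def)
  show "chi' n = chi'' n"
  proof (cases "coprime n (int d)")
    case True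
    then obtain y where y: "[y = n] (mod int d)" "coprime y (int q)"
      using exists_coprime_lift D(3) assms(1) by blast
    then show ?thesis
      using assms(2,3) D(1,2) dirichlet_character_cong unfolding induced_from_def by metis
  next
    case False
    then show ?thesis using D(1,2) unfolding dirichlet_character_def by metis
  qed
qed

lemma induced_from_common:
  assumes chi: "dirichlet_character q chi"
    and 1: "induced_from q chi d1 chi1" and 2: "induced_from q chi d2 chi2"
    and m: "coprime m (int q)" and m': "coprime m' (int q)"
    and c: "[m = m'] (mod int (gcd d1 d2))"
  shows "chi m = chi m'"
proof -
  have q: "q > 0" and d: "d1 dvd q" "d2 dvd q"
    and D: "dirichlet_character d1 chi1" "dirichlet_character d2 chi2"
    and I: "\<And>n. coprime n (int q) \<Longrightarrow> chi n = chi1 n" "\<And>n. coprime n (int q) \<Longrightarrow> chi n = chi2 n"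
    using chi 1 2 by (auto simp: induced_from_def dirichlet_character_def)
  obtain u v where uv: "u * int d1 + v * int d2 = gcd (int d1) (int d2)"
    using bezout_int by blast
  have "gcd (int d1) (int d2) dvd m' - m"
    using c by (simp add: cong_iff_dvd_diff cong_sym dvd_diff_commute)
  then obtain k where k: "m' - m = gcd (int d1) (int d2) * k" by blast
  define x where "x = m + k * u * int d1"
  have x1: "[x = m] (mod int d1)" by (simp add: x_def cong_iff_dvd_diff)
  have "x - m' = k * u * int d1 - gcd (int d1) (int d2) * k" using k by (simp add: x_def)
  also have "\<dots> = (- k * v) * int d2" unfolding uv[symmetric] by (simp add: algebra_simps)
  finally have x2: "[x = m'] (mod int d2)" by (simp add: cong_iff_dvd_diff)
  have "coprime m (int d1)" "coprime m' (int d2)"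
    using m m' d by (meson coprime_divisors dvd_refl of_nat_dvd_iff)+
  then have "coprime x (int d1)" "coprime x (int d2)"
    using x1 x2 by (metis cong_imp_coprime cong_sym)+
  then have "coprime x (int d1 * int d2)" by simp
  moreover have "lcm (int d1) (int d2) dvd int d1 * int d2" by (intro lcm_least) simp_all
  ultimately have "coprime x (int (lcm d1 d2))"
    by (metis coprime_divisors dvd_refl lcm_int_int_eq)
  then obtain y where y: "[y = x] (mod int (lcm d1 d2))" "coprime y (int q)"
    using exists_coprime_lift[of q "lcm d1 d2" x] q d by auto
  have "int d1 dvd int (lcm d1 d2)" "int d2 dvd int (lcm d1 d2)"
    by (simp_all only: of_nat_dvd_iff dvd_lcm1 dvd_lcm2)
  then have "[y = m] (mod int d1)" "[y = m'] (mod int d2)"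
    using y(1) x1 x2 by (meson cong_dvd_modulus cong_trans)+
  then show ?thesis
    using I m m' y(2) D dirichlet_character_cong by metis
qed

lemma induced_from_gcd:
  assumes chi: "dirichlet_character q chi"
    and 1: "induced_from q chi d1 chi1" and 2: "induced_from q chi d2 chi2"
  shows "\<exists>chi'. induced_from q chi (gcd d1 d2) chi'"
proof -
  define g where "g = gcd d1 d2"
  have q: "q > 0" and mult: "\<And>m n. chi (m * n) = chi m * chi n"
    and nz: "\<And>n. chi n \<noteq> 0 \<longleftrightarrow> coprime n (int q)"
    using chi by (auto simp: dirichlet_character_def)
  have g: "g dvd q" using 1 by (auto simp: g_def induced_from_def)
  then have g0: "g > 0" using q by (auto intro: Nat.gr0I)
  define l where "l n = (SOME y. [y = n] (mod int g) \<and> coprime y (int q))" for n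
  have l: "[l n = n] (mod int g)" "coprime (l n) (int q)" if "coprime n (int g)" for n
    using someI_ex[OF exists_coprime_lift[OF q g that]] unfolding l_def by auto
  define chi' where "chi' n = (if coprime n (int g) then chi (l n) else 0)" for n
  have key: "chi' n = chi y" if "coprime y (int q)" "[y = n] (mod int g)" for n y
  proof -
    have "coprime y (int g)" using that(1) g by (meson coprime_divisors dvd_refl of_nat_dvd_iff)
    then have n: "coprime n (int g)" using that(2) by (metis cong_imp_coprime)
    have "[l n = y] (mod int g)" using l(1)[OF n] that(2) by (metis cong_sym cong_trans)
    then have "chi (l n) = chi y"
      using induced_from_common[OF chi 1 2 l(2)[OF n] that(1)] by (simp add: g_def)
    then show ?thesis using n by (simp add: chi'_def)
  qed
  have "dirichlet_character g chi'"
    unfolding dirichlet_character_def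
  proof (intro conjI allI)
    show "g > 0" by (fact g0)
    fix n
    show "chi' n \<noteq> 0 \<longleftrightarrow> coprime n (int g)" using l nz by (auto simp: chi'_def)
    show "chi' (n + int g) = chi' n"
    proof (cases "coprime n (int g)")
      case True
      have "[l n = n + int g] (mod int g)" using l(1)[OF True] by (simp add: cong_def)
      then show ?thesis using key l[OF True] by metis
    next
      case False
      then have "\<not> coprime (n + int g) (int g)" by (simp add: coprime_iff_gcd_eq_1)
      then show ?thesis using False by (simp add: chi'_def)
    qed
  next
    fix m n
    show "chi' (m * n) = chi' m * chi' n"
    proof (cases "coprime m (int g) \<and> coprime n (int g)")
      case True
      have "coprime (l m * l n) (int q)" "[l m * l n = m * n] (mod int g)"
        using l True by (auto intro: cong_mult)
      then have "chi' (m * n) = chi (l m * l n)" by (rule key)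
      then show ?thesis using True mult by (simp add: chi'_def)
    next
      case False
      then show ?thesis by (auto simp: chi'_def)
    qed
  qed
  then have "induced_from q chi g chi'"
    using g key by (auto simp: induced_from_def)
  then show ?thesis by (auto simp: g_def)
qed

theorem unique_primitive_inducing:
  assumes chi: "dirichlet_character q chi"
  shows "\<exists>d chi'. primitive_character d chi' \<and> induced_from q chi d chi' \<and>
    (\<forall>e \<eta>. primitive_character e \<eta> \<and> induced_from q chi e \<eta> \<longrightarrow> e = d \<and> \<eta> = chi')"
proof -
  have q: "q > 0" using chi by (simp add: dirichlet_character_def)
  define d where "d = (LEAST d. \<exists>chi'. induced_from q chi d chi')"
  have ex: "\<exists>d chi'. induced_from q chi d chi'" using induced_from_refl[OF chi] by blast
  have "\<exists>chi'. induced_from q chi d chi'" unfolding d_def by (rule LeastI_ex[OF ex])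
  then obtain chi' where chi': "induced_from q chi d chi'" by blast
  have min: "d \<le> e" if "induced_from q chi e \<eta>" for e \<eta>
    unfolding d_def by (rule Least_le) (use that in blast)
  have "d > 0" using chi' by (simp add: induced_from_def dirichlet_character_def)
  have "primitive_character d chi'"
    unfolding primitive_character_def
  proof (intro conjI allI impI)
    show "dirichlet_character d chi'" using chi' by (simp add: induced_from_def)
    fix e \<eta> assume e: "induced_from d chi' e \<eta>"
    then have "e \<le> d" using \<open>d > 0\<close> by (simp add: induced_from_def dvd_imp_le)
    moreover have "d \<le> e" using induced_from_trans[OF chi' e] by (rule min)
    ultimately show "e = d" by simp
  qed
  moreover have "e = d \<and> \<eta> = chi'" if e: "primitive_character e \<eta>" "induced_from q chi e \<eta>" for e \<eta>
  proof -
    obtain \<theta> where \<theta>: "induced_from q chi (gcd e d) \<theta>"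
      using induced_from_gcd[OF chi e(2) chi'] by blast
    have "gcd e d = d"
      using min[OF \<theta>] \<open>d > 0\<close> by (simp add: dvd_imp_le le_antisym)
    then have "d dvd e" by (metis gcd_dvd1)
    have "induced_from e \<eta> d chi'"
      unfolding induced_from_def
    proof (intro conjI allI impI)
      show "d dvd e" by (fact \<open>d dvd e\<close>)
      show "dirichlet_character d chi'" using chi' by (simp add: induced_from_def)
      fix n assume n: "coprime n (int e)"
      obtain y where y: "[y = n] (mod int e)" "coprime y (int q)"
        using exists_coprime_lift[OF q _ n] e(2) by (auto simp: induced_from_def)
      have "[y = n] (mod int d)" using y(1) \<open>d dvd e\<close> by (meson cong_dvd_modulus of_nat_dvd_iff)
      then show "\<eta> n = chi' n"
        using y e(2) chi' dirichlet_character_cong unfolding induced_from_def by metis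
    qed
    then have "d = e" using e(1) by (auto simp: primitive_character_def)
    then show ?thesis using induced_from_unique[OF q] e(2) chi' by blast
  qed
  ultimately show ?thesis using chi' by blast
qed

corollary prim_char_inducing:
  assumes "dirichlet_character q chi"
  shows "primitive_character (conductor q chi) (prim_char q chi)"
    and "induced_from q chi (conductor q chi) (prim_char q chi)"
proof -
  obtain d chi' where *: "primitive_character d chi'" "induced_from q chi d chi'"
    and u: "\<And>e \<eta>. primitive_character e \<eta> \<Longrightarrow> induced_from q chi e \<eta> \<Longrightarrow> e = d \<and> \<eta> = chi'"
    using unique_primitive_inducing[OF assms] by blast
  have "conductor q chi = d" unfolding conductor_def by (rule the_equality) (use * u in blast)+
  moreover have "prim_char q chi = chi'" unfolding prim_char_def by (rule the_equality) (use * u in blast)+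
  ultimately show "primitive_character (conductor q chi) (prim_char q chi)"
    "induced_from q chi (conductor q chi) (prim_char q chi)" using * by simp_all
qed

lemma finite_dirichlet_characters: "finite {chi. dirichlet_character q chi}"
proof (cases "q = 0")
  case False
  then have "inj_on (\<lambda>chi. restrict chi {0..<int q}) {chi. dirichlet_character q chi}"
  proof (intro inj_onI ext)
    fix chi \<eta> n
    assume "chi \<in> {chi. dirichlet_character q chi}" "\<eta> \<in> {chi. dirichlet_character q chi}"
      and eq: "restrict chi {0..<int q} = restrict \<eta> {0..<int q}"
    then have "chi n = chi (n mod int q)" "\<eta> n = \<eta> (n mod int q)"
      by (auto intro!: dirichlet_character_cong)
    moreover have "n mod int q \<in> {0..<int q}" using False by simp
    ultimately show "chi n = \<eta> n" using eq by (metis restrict_apply')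
  qed
  moreover have "(\<lambda>chi. restrict chi {0..<int q}) ` {chi. dirichlet_character q chi} \<subseteq>
    {0..<int q} \<rightarrow>\<^sub>E insert 0 {z. z ^ totient q = 1}"
  proof (rule image_subsetI)
    fix chi assume "chi \<in> {chi. dirichlet_character q chi}"
    then have chi: "dirichlet_character q chi" by simp
    have "chi n \<in> insert 0 {z. z ^ totient q = 1}" for n
    proof (cases "chi n = 0")
      case False
      have mult: "chi (x * y) = chi x * chi y" for x y using chi by (simp add: dirichlet_character_def)
      have one: "chi 1 = 1"
        using mult[of 1 1] chi by (auto simp: dirichlet_character_def)
      have pow: "chi (x ^ k) = chi x ^ k" for x k by (induction k) (simp_all add: one mult)
      have "coprime n (int q)" using False chi by (simp add: dirichlet_character_def)
      then have "coprime (n mod int q) (int q)" using \<open>q \<noteq> 0\<close> by simp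
      then have "coprime (nat (n mod int q)) q" using \<open>q \<noteq> 0\<close>
        by (metis coprime_int_iff nat_0_le of_nat_0_less_iff gr0I pos_mod_sign)
      then have "[nat (n mod int q) ^ totient q = 1] (mod q)" by (rule euler_theorem)
      then have "[int (nat (n mod int q) ^ totient q) = int 1] (mod int q)"
        by (simp only: cong_int_iff)
      then have "[(n mod int q) ^ totient q = 1] (mod int q)" using \<open>q \<noteq> 0\<close> by simp
      then have "[n ^ totient q = 1] (mod int q)" by (simp add: cong_def power_mod)
      from dirichlet_character_cong[OF chi this] show ?thesis by (simp add: pow one)
    qed simp
    then show "restrict chi {0..<int q} \<in> {0..<int q} \<rightarrow>\<^sub>E insert 0 {z. z ^ totient q = 1}" by auto
  qed
  moreover have "finite ({0..<int q} \<rightarrow>\<^sub>E insert (0::complex) {z. z ^ totient q = 1})"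
    using False by (intro finite_PiE) (auto intro!: finite_roots_unity simp: Suc_le_eq)
  ultimately show ?thesis by (meson finite_imageD finite_subset)
qed (simp add: dirichlet_character_def)

end

theory Submission
  imports Defs "HOL-Library.Real_Mod" "HOL-Real_Asymp.Real_Asymp"
begin

text \<open>
  Orthogonality of the characters modulo \<open>c\<close> turns the left-hand side into the mean square of the transforms
  \<open>T(\<psi>) = (\<Sum>a. \<psi>(a) S(a,c))\<close>, so it suffices to evaluate \<open>\<bar>T(\<psi>)\<bar>\<close>. Inserting the sine series of the
  factor \<open>B1 (n/q1 + aj/c)\<close> and summing over \<open>n\<close> and \<open>a\<close> produces \<open>\<tau>(cnj chi1)\<close> and a
  Gauss sum of \<open>\<psi>\<close> at \<open>lj\<close>, up to a factor that vanishes unless \<open>\<psi> chi1\<close> is odd. The terms with \<open>gcd(j,c) = c/d\<close>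
  contribute only if \<open>q(\<psi>)\<close> divides \<open>d\<close>; then the Gauss sum reduces to modulus \<open>d\<close> at the cost of
  \<open>\<phi>(c)/\<phi>(d)\<close>, and Moebius inversion expresses it through \<open>\<tau>(\<psi>\<^sup>\<star>)\<close>, so that the sum over \<open>l\<close>
  becomes \<open>L(1, cnj \<psi>\<^sup>\<star> chi1)\<close> times a finite divisor sum. The sum over \<open>j\<close>
  is of the same kind and gives \<open>L(1, (\<psi> chi2)\<^sup>\<star>)\<close>.
\<close>

section \<open>Characters and Gauss sums\<close>

text \<open>All series here converge only conditionally, so none is ever rearranged: infinite sums
  are interchanged only with finite ones, and each identity arises by evaluating one and the same
  ordered series in two ways. The convergence of the odd L-values also comes from the sine series,
  since an odd periodic function is a finite combination of sines.

  The obstacle is imprimitivity. \<open>psi\<close> runs through all characters modulo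
  \<open>c\<close>, and neither \<open>psi\<close> nor \<open>psi * chi2\<close> need be primitive,
  so their Gauss sums do not separate at frequencies sharing a factor with \<open>c\<close>. Sorting
  \<open>j\<close> by \<open>gcd(j,c) = c/d\<close> isolates this. The factor
  \<open>chi2(c/d)\<close> then helps twice: where it is nonzero, \<open>c/d\<close> is coprime to
  \<open>q2\<close>, hence \<open>q2\<close> divides \<open>d\<close>, and on units modulo
  \<open>d\<close> the product of \<open>psi*\<close> and \<open>chi2\<close> is the single
  primitive character \<open>(psi chi2)*\<close>.

  Constants: each of the two \<open>B1\<close> factors yields \<open>i/pi\<close>, so the transform
  carries \<open>-1/pi^2\<close> and its squared modulus \<open>1/pi^4\<close>. The Gauss sum
  reduction gives \<open>phi(c)\<close>, squared in the mean square, and Parseval cancels one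
  copy.\<close>

lemma char_mult: "dirichlet_character q chi \<Longrightarrow> chi (m * n) = chi m * chi n"
  and char_modulus_pos: "dirichlet_character q chi \<Longrightarrow> q > 0"
  and char_eq_0_iff: "dirichlet_character q chi \<Longrightarrow> chi n = 0 \<longleftrightarrow> \<not> coprime n (int q)"
  by (auto simp: dirichlet_character_def)

lemma char_one: assumes "dirichlet_character q chi" shows "chi 1 = 1"
  using char_mult[OF assms, of 1 1] char_eq_0_iff[OF assms, of 1] by auto

lemma char_power: "dirichlet_character q chi \<Longrightarrow> chi (n ^ k) = chi n ^ k"
  by (induction k) (simp_all add: char_one char_mult)

lemma coprime_dvd_modulus: "coprime n (int c) \<Longrightarrow> d dvd c \<Longrightarrow> coprime n (int d)"
  by (meson coprime_divisors dvd_refl of_nat_dvd_iff)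

lemma euler_theorem_int:
  fixes n :: int
  assumes "q > 0" "coprime n (int q)"
  shows "[n ^ totient q = 1] (mod int q)"
proof -
  have "coprime (nat (n mod int q)) q"
    using assms by (metis coprime_int_iff coprime_mod_left_iff nat_0_le of_nat_0_less_iff of_nat_0_eq_iff
      pos_mod_sign less_irrefl)
  then have "[int (nat (n mod int q) ^ totient q) = int 1] (mod int q)"
    by (simp only: cong_int_iff euler_theorem)
  then show ?thesis using assms by (simp add: cong_def power_mod)
qed

lemma norm_char:
  assumes "dirichlet_character q chi" "coprime n (int q)"
  shows "cmod (chi n) = 1"
proof -
  have q: "q > 0" using assms char_modulus_pos by blast
  have "chi n ^ totient q = 1"
    using dirichlet_character_cong[OF assms(1) euler_theorem_int[OF q assms(2)]]
    by (simp add: char_power[OF assms(1)] char_one[OF assms(1)])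
  then have "cmod (chi n) ^ totient q = 1" by (metis norm_one norm_power)
  then show ?thesis using q by (intro power_eq_imp_eq_base[of "cmod (chi n)" "totient q" 1]) simp_all
qed

lemma cnj_char_mult:
  assumes "dirichlet_character q chi" "coprime n (int q)"
  shows "cnj (chi n) * chi n = 1"
  using norm_char[OF assms] by (simp add: complex_norm_square[symmetric] mult.commute)

lemma dirichlet_character_cnj:
  "dirichlet_character q chi \<Longrightarrow> dirichlet_character q (\<lambda>n. cnj (chi n))"
  by (simp add: dirichlet_character_def)

lemma induced_from_cnj:
  "induced_from q chi d chi' \<Longrightarrow> induced_from q (\<lambda>n. cnj (chi n)) d (\<lambda>n. cnj (chi' n))"
  by (simp add: induced_from_def dirichlet_character_cnj)

lemma primitive_character_cnj:
  assumes "primitive_character q chi"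
  shows "primitive_character q (\<lambda>n. cnj (chi n))"
  unfolding primitive_character_def
proof (intro conjI allI impI)
  show "dirichlet_character q (\<lambda>n. cnj (chi n))"
    using assms by (simp add: primitive_character_def dirichlet_character_cnj)
  fix d chi' assume "induced_from q (\<lambda>n. cnj (chi n)) d chi'"
  from induced_from_cnj[OF this] show "d = q"
    using assms by (auto simp: primitive_character_def)
qed

lemma dirichlet_character_mult:
  assumes "dirichlet_character q chi" "dirichlet_character r eta" "r dvd q"
  shows "dirichlet_character q (\<lambda>n. chi n * eta n)"
  unfolding dirichlet_character_def
proof (intro conjI allI)
  show "q > 0" using assms(1) by (rule char_modulus_pos)
  fix m n
  show "chi (m * n) * eta (m * n) = chi m * eta m * (chi n * eta n)"
    using assms by (simp add: char_mult)
  have "[n + int q = n] (mod int q)" "[n + int q = n] (mod int r)"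
    using assms(3) by (auto simp: cong_iff_dvd_diff)
  then show "chi (n + int q) * eta (n + int q) = chi n * eta n"
    using assms(1,2) by (metis dirichlet_character_cong)
  have "coprime n (int q) \<Longrightarrow> coprime n (int r)"
    using assms(3) by (meson coprime_divisors dvd_refl of_nat_dvd_iff)
  then show "(chi n * eta n \<noteq> 0) = coprime n (int q)"
    using assms(1,2) by (auto simp: char_eq_0_iff)
qed

lemma inverse_mod_int:
  fixes u :: int
  assumes "coprime u (int q)"
  obtains v where "[u * v = 1] (mod int q)" "coprime v (int q)"
proof -
  obtain v where v: "[u * v = 1] (mod int q)" using assms cong_solve_coprime_int by blast
  have "coprime (u * v) (int q)" using v by (metis cong_imp_coprime cong_sym coprime_1_left)
  then show ?thesis using that v by simp
qed

text \<open>Units modulo \<open>d\<close> lift to units modulo \<open>q\<close>, so a character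
  trivial on the kernel of reduction factors through modulus \<open>d\<close>. It is used
  contrapositively: when \<open>chi\<close> is not induced from \<open>d\<close>, some unit
  congruent to 1 modulo \<open>d\<close> has value different from 1, and multiplying by it
  annihilates character sums whose other factor has period \<open>d\<close>.\<close>

lemma induced_from_exists:
  assumes chi: "dirichlet_character q chi" and d: "d dvd q"
    and triv: "\<And>u. coprime u (int q) \<Longrightarrow> [u = 1] (mod int d) \<Longrightarrow> chi u = 1"
  shows "\<exists>chi'. induced_from q chi d chi'"
proof -
  have q: "q > 0" by (rule char_modulus_pos[OF chi])
  then have d0: "d > 0" using d by (auto intro: Nat.gr0I)
  define l where "l n = (SOME y. [y = n] (mod int d) \<and> coprime y (int q))" for n
  have l: "[l n = n] (mod int d)" "coprime (l n) (int q)" if "coprime n (int d)" for n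
    using someI_ex[OF exists_coprime_lift[OF q d that]] unfolding l_def by auto
  define chi' where "chi' n = (if coprime n (int d) then chi (l n) else 0)" for n
  have key: "chi' n = chi y" if y: "coprime y (int q)" "[y = n] (mod int d)" for n y
  proof -
    have "coprime y (int d)" using y(1) d by (meson coprime_divisors dvd_refl of_nat_dvd_iff)
    then have n: "coprime n (int d)" using y(2) by (metis cong_imp_coprime)
    have ly: "[l n = y] (mod int d)" using l(1)[OF n] y(2) by (metis cong_sym cong_trans)
    \<comment> \<open>With \<open>z\<close> inverse to \<open>y\<close>, the product
      \<open>l n * z\<close> lies in the kernel of reduction modulo \<open>d\<close>, so
      \<open>l n\<close> and \<open>y\<close> have equal values.\<close>
    obtain z where z: "[y * z = 1] (mod int q)" "coprime z (int q)"
      using inverse_mod_int[OF y(1)] by blast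
    have "[y * z = 1] (mod int d)" using z(1) d by (meson cong_dvd_modulus of_nat_dvd_iff)
    then have "[l n * z = 1] (mod int d)" using cong_mult[OF ly cong_refl[of z]] cong_trans by blast
    then have "chi (l n * z) = 1" using triv l(2)[OF n] z(2) by simp
    moreover have "chi (y * z) = 1"
      using dirichlet_character_cong[OF chi z(1)] char_one[OF chi] by simp
    ultimately have "chi (l n) * chi z = chi y * chi z" by (simp add: char_mult[OF chi])
    moreover have "chi z \<noteq> 0" using z(2) by (simp add: char_eq_0_iff[OF chi])
    ultimately show ?thesis using n by (simp add: chi'_def)
  qed
  have "dirichlet_character d chi'"
    unfolding dirichlet_character_def
  proof (intro conjI allI)
    show "d > 0" by (fact d0)
    fix m n
    show "chi' n \<noteq> 0 \<longleftrightarrow> coprime n (int d)" using l by (auto simp: chi'_def char_eq_0_iff[OF chi])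
    show "chi' (n + int d) = chi' n"
    proof (cases "coprime n (int d)")
      case True
      have "[l n = n + int d] (mod int d)" using l(1)[OF True] by (simp add: cong_def)
      then show ?thesis using key l[OF True] by metis
    next
      case False
      then have "\<not> coprime (n + int d) (int d)" by (simp add: coprime_iff_gcd_eq_1)
      then show ?thesis using False by (simp add: chi'_def)
    qed
    show "chi' (m * n) = chi' m * chi' n"
    proof (cases "coprime m (int d) \<and> coprime n (int d)")
      case True
      have "coprime (l m * l n) (int q)" "[l m * l n = m * n] (mod int d)"
        using l True by (auto intro: cong_mult)
      then have "chi' (m * n) = chi (l m * l n)" by (rule key)
      then show ?thesis using True by (simp add: chi'_def char_mult[OF chi])
    next
      case False
      then show ?thesis by (auto simp: chi'_def)
    qed
  qed
  then have "induced_from q chi d chi'" using d key by (auto simp: induced_from_def)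
  then show ?thesis by blast
qed

text \<open>The primitive character inducing \<open>chi'\<close> also induces \<open>chi\<close>, so
  by uniqueness it is the one that defines the conductor of \<open>chi\<close>.\<close>

lemma conductor_dvd:
  assumes chi: "dirichlet_character q chi" and ind: "induced_from q chi d chi'"
  shows "conductor q chi dvd d"
proof -
  have chi': "dirichlet_character d chi'" using ind by (simp add: induced_from_def)
  note p = prim_char_inducing[OF chi']
  have "conductor q chi = conductor d chi'"
    using unique_primitive_inducing[OF chi] p(1) induced_from_trans[OF ind p(2)]
      prim_char_inducing[OF chi] by metis
  then show ?thesis using p(2) by (simp add: induced_from_def)
qed

section \<open>Additive characters and Fourier sums of primitive characters\<close>

definition ee :: "nat \<Rightarrow> int \<Rightarrow> complex" where
  "ee q n = cis (2 * pi * of_int n / of_nat q)"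

lemma ee_0 [simp]: "ee q 0 = 1" by (simp add: ee_def)

lemma ee_add: "ee q (m + n) = ee q m * ee q n"
  by (simp add: ee_def cis_mult ring_distribs add_divide_distrib)

lemma ee_minus: "ee q (- n) = cnj (ee q n)"
  by (simp add: ee_def cis_cnj)

lemma ee_power: "ee q n ^ k = ee q (int k * n)"
  by (induction k) (simp_all add: ee_add ring_distribs)

lemma ee_mult_cancel: "t > 0 \<Longrightarrow> ee (q * t) (n * int t) = ee q n"
  by (simp add: ee_def mult.assoc)

lemma ee_eq_1_iff: assumes "q > 0" shows "ee q n = 1 \<longleftrightarrow> int q dvd n"
proof -
  have "ee q n = 1 \<longleftrightarrow> (\<exists>k::int. real_of_int n = real_of_int (int q * k))"
    unfolding ee_def cis_eq_1_iff using assms by (simp add: field_simps)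
  then show ?thesis by (simp only: of_int_eq_iff dvd_def)
qed

lemma ee_cong: assumes "q > 0" "[m = n] (mod int q)" shows "ee q m = ee q n"
proof -
  have "ee q (m - n) = 1" using assms by (simp add: ee_eq_1_iff cong_iff_dvd_diff)
  then show ?thesis using ee_add[of q "m - n" n] by simp
qed

lemma gauss_sum_ee: "gauss_sum q chi = (\<Sum>n\<in>{0..<int q}. chi n * ee q n)"
  unfolding gauss_sum_def ee_def cis_conv_exp by (simp add: mult_ac)

lemma sum_residues_mult:
  fixes f :: "int \<Rightarrow> 'a :: comm_monoid_add"
  assumes "q > 0" "coprime u (int q)" and per: "\<And>m n. [m = n] (mod int q) \<Longrightarrow> f m = f n"
  shows "(\<Sum>n\<in>{0..<int q}. f (u * n)) = (\<Sum>n\<in>{0..<int q}. f n)"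
proof -
  obtain v where v: "[u * v = 1] (mod int q)" using inverse_mod_int[OF assms(2)] by blast
  have uv: "u * (v * n mod int q) mod int q = n" "v * (u * n mod int q) mod int q = n"
    if "n \<in> {0..<int q}" for n
  proof -
    have "[u * v * n = n] (mod int q)" using cong_mult[OF v cong_refl[of n]] by simp
    then show "u * (v * n mod int q) mod int q = n" "v * (u * n mod int q) mod int q = n"
      using that by (simp_all add: cong_def mod_mult_right_eq mult_ac)
  qed
  show ?thesis
    by (rule sum.reindex_bij_witness[where i = "\<lambda>n. v * n mod int q" and j = "\<lambda>n. u * n mod int q"])
      (use uv assms(1) in \<open>auto intro!: per simp: cong_def\<close>)
qed

lemma sum_ee:
  assumes "q > 0"
  shows "(\<Sum>k\<in>{0..<int q}. ee q (n * k)) = (if int q dvd n then of_nat q else 0)"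
proof (cases "int q dvd n")
  case True
  then have "ee q (n * k) = 1" for k using assms by (simp add: ee_eq_1_iff)
  then show ?thesis using True by simp
next
  case False
  have "(\<Sum>k\<in>{0..<int q}. ee q (n * k)) = (\<Sum>k<q. ee q n ^ k)"
    by (rule sum.reindex_bij_witness[where i = int and j = nat]) (auto simp: ee_power mult.commute)
  also have "\<dots> = 0"
    using False assms geometric_sum[of "ee q n" q] by (simp add: ee_eq_1_iff ee_power)
  finally show ?thesis using False by simp
qed

text \<open>Replacing \<open>n\<close> by \<open>u * n\<close> shows that the sum at frequency
  \<open>l * u\<close> times \<open>chi u\<close> is the sum at \<open>l\<close>. If
  \<open>l\<close> is a unit, taking its inverse for \<open>u\<close> reduces to frequency 1. If
  not, primitivity supplies a \<open>u\<close> that fixes the frequency but has \<open>chi u\<close>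
  different from 1.\<close>

lemma primitive_fourier:
  assumes prim: "primitive_character q chi"
  shows "(\<Sum>n\<in>{0..<int q}. chi n * ee q (l * n)) = cnj (chi l) * gauss_sum q chi"
proof -
  have chi: "dirichlet_character q chi" using prim by (simp add: primitive_character_def)
  have q: "q > 0" by (rule char_modulus_pos[OF chi])
  define X where "X = (\<Sum>n\<in>{0..<int q}. chi n * ee q (l * n))"
  have X: "(\<Sum>n\<in>{0..<int q}. chi n * ee q (l * u * n)) * chi u = X" if "coprime u (int q)" for u
  proof -
    have "X = (\<Sum>n\<in>{0..<int q}. chi (u * n) * ee q (l * (u * n)))" unfolding X_def
      by (rule sum_residues_mult[OF q that, symmetric])
        (auto intro!: arg_cong2[of _ _ _ _ times] dirichlet_character_cong[OF chi] ee_cong[OF q] cong_mult)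
    then show ?thesis by (simp add: char_mult[OF chi] sum_distrib_left mult_ac)
  qed
  show ?thesis
  proof (cases "coprime l (int q)")
    case True
    then obtain v where v: "[l * v = 1] (mod int q)" "coprime v (int q)"
      using inverse_mod_int by blast
    have "ee q (l * v * n) = ee q n" for n
      using cong_mult[OF v(1) cong_refl[of n]] by (intro ee_cong[OF q]) simp
    then have "gauss_sum q chi * chi v = X" using X[OF v(2)] by (simp add: gauss_sum_ee)
    moreover have "chi l * chi v = 1"
      using dirichlet_character_cong[OF chi v(1)] by (simp add: char_mult[OF chi] char_one[OF chi])
    then have "chi v = cnj (chi l)"
      using cnj_char_mult[OF chi True] by (metis mult.commute mult.left_commute mult.right_neutral)
    ultimately show ?thesis by (simp add: X_def mult.commute)
  next
    case False
    \<comment> \<open>A unit \<open>u\<close> congruent to 1 modulo \<open>q div g\<close> satisfies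
      \<open>l * u = l\<close> modulo \<open>q\<close>. Since \<open>q div g\<close> is a proper
      divisor of \<open>q\<close>, primitivity yields such a \<open>u\<close> with
      \<open>chi u\<close> different from 1, which forces \<open>X = 0\<close>.\<close>
    define g where "g = nat (gcd l (int q))"
    have g: "int g = gcd l (int q)" by (simp add: g_def)
    have "int g dvd int q" by (simp add: g)
    then have gq: "g dvd q" by simp
    have "g \<noteq> 1" using False by (simp add: g_def coprime_iff_gcd_eq_1 nat_eq_iff)
    have "g \<noteq> 0" using q gq by auto
    have "q div g \<noteq> q"
      using \<open>g \<noteq> 1\<close> \<open>g \<noteq> 0\<close> q by (simp add: div_eq_dividend_iff)
    then have "\<not> (\<exists>chi'. induced_from q chi (q div g) chi')"
      using prim by (auto simp: primitive_character_def)
    moreover have "q div g dvd q" using gq by (metis dvd_div_mult_self dvd_triv_left)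
    ultimately obtain u where u: "coprime u (int q)" "[u = 1] (mod int (q div g))" "chi u \<noteq> 1"
      using induced_from_exists[OF chi, of "q div g"] by blast
    have "int g dvd l" by (simp add: g)
    moreover have "int (q div g) dvd u - 1" using u(2) by (simp add: cong_iff_dvd_diff)
    ultimately have "int g * int (q div g) dvd l * (u - 1)" by (rule mult_dvd_mono)
    then have "int q dvd l * u - l"
      using gq by (simp flip: of_nat_mult add: ring_distribs)
    then have "[l * u = l] (mod int q)" by (simp add: cong_iff_dvd_diff)
    then have "ee q (l * u * n) = ee q (l * n)" for n
      by (intro ee_cong[OF q] cong_mult cong_refl)
    then have "X * chi u = X" using X[OF u(1)] by (simp add: X_def)
    then have "X = 0" using u(3) by simp
    then show ?thesis using False by (simp add: X_def char_eq_0_iff[OF chi])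
  qed
qed

lemma sum_int_residues_split:
  fixes f :: "int \<Rightarrow> 'a :: comm_monoid_add"
  assumes "r > 0"
  shows "(\<Sum>i\<in>{0..<int (r * t)}. f i) = (\<Sum>i\<in>{0..<int r}. \<Sum>s\<in>{0..<int t}. f (i + int r * s))"
proof -
  have "(\<Sum>i\<in>{0..<int (r * t)}. f i) = (\<Sum>(i,s)\<in>{0..<int r} \<times> {0..<int t}. f (i + int r * s))"
  proof (rule sum.reindex_bij_witness[where i = "\<lambda>(i,s). i + int r * s" and j = "\<lambda>i. (i mod int r, i div int r)"])
    fix a assume a: "a \<in> {0..<int (r * t)}"
    have "a div int r < int t"
    proof (rule ccontr)
      assume "\<not> a div int r < int t"
      then have "int r * int t \<le> int r * (a div int r)" by (intro mult_left_mono) auto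
      also have "\<dots> \<le> a" using assms pos_mod_sign[of "int r" a] by (simp add: minus_mod_eq_mult_div[symmetric])
      finally show False using a by simp
    qed
    then show "(a mod int r, a div int r) \<in> {0..<int r} \<times> {0..<int t}"
      using a assms by (simp add: pos_imp_zdiv_nonneg_iff)
  next
    fix b assume "b \<in> {0..<int r} \<times> {0..<int t}"
    then obtain i s where b: "b = (i, s)" "0 \<le> i" "i < int r" "0 \<le> s" "s < int t" by auto
    then have "int r * s \<le> int r * (int t - 1)" using assms by (intro mult_left_mono) auto
    then show "(case b of (i, s) \<Rightarrow> i + int r * s) \<in> {0..<int (r * t)}"
      using b by (simp add: algebra_simps)
  qed (use assms in auto)
  then show ?thesis by (simp add: sum.cartesian_product)
qed

text \<open>With \<open>i\<close> split as \<open>i + r * s\<close>, the sum over \<open>s\<close>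
  is a full sum of \<open>t\<close>-th roots of unity and detects \<open>t dvd l\<close>. The factor
  \<open>t\<close> that it leaves later cancels against the denominator \<open>l\<close> of the
  L-series.\<close>

lemma primitive_fourier_multiple:
  assumes prim: "primitive_character r chi" and t: "t > 0"
  shows "(\<Sum>i\<in>{0..<int (r * t)}. chi i * ee (r * t) (l * i)) =
    (if int t dvd l then of_nat t * (gauss_sum r chi * cnj (chi (l div int t))) else 0)"
proof -
  have chi: "dirichlet_character r chi" using prim by (simp add: primitive_character_def)
  have r: "r > 0" by (rule char_modulus_pos[OF chi])
  have 1: "chi (i + int r * s) * ee (r * t) (l * (i + int r * s)) =
      chi i * ee (r * t) (l * i) * ee t (l * s)" for i s
  proof -
    have "chi (i + int r * s) = chi i"
      by (rule dirichlet_character_cong[OF chi]) (simp add: cong_def)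
    moreover have "ee (r * t) (l * (int r * s)) = ee t (l * s)"
      using ee_mult_cancel[OF r, of t "l * s"] by (simp add: mult_ac)
    ultimately show ?thesis by (simp add: ring_distribs ee_add)
  qed
  have "(\<Sum>i\<in>{0..<int (r * t)}. chi i * ee (r * t) (l * i)) =
      (\<Sum>i\<in>{0..<int r}. chi i * ee (r * t) (l * i) * (\<Sum>s\<in>{0..<int t}. ee t (l * s)))"
    by (simp add: sum_int_residues_split[OF r] 1 sum_distrib_left del: of_nat_mult)
  also have "\<dots> = (if int t dvd l then of_nat t * (gauss_sum r chi * cnj (chi (l div int t))) else 0)"
  proof (cases "int t dvd l")
    case True
    then obtain m where m: "l = int t * m" by blast
    have *: "ee (r * t) (l * i) = ee r (m * i)" for i
      using ee_mult_cancel[OF t, of r "m * i"] by (simp add: m mult_ac)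
    have "(\<Sum>i\<in>{0..<int r}. chi i * ee (r * t) (l * i) * (\<Sum>s\<in>{0..<int t}. ee t (l * s))) =
        (\<Sum>i\<in>{0..<int r}. chi i * ee r (m * i)) * of_nat t"
      unfolding * sum_ee[OF t] using True by (simp add: sum_distrib_right)
    then show ?thesis using True t by (simp add: primitive_fourier[OF prim] m)
  qed (simp add: sum_ee t)
  finally show ?thesis .
qed

section \<open>Orthogonality of characters\<close>

text \<open>A character of a subgroup of the units modulo \<open>q\<close>, the subgroup being
  represented by the union \<open>H\<close> of its residue classes. Closure under inverses is
  omitted because it follows from Euler's theorem.\<close>

definition partial_character :: "nat \<Rightarrow> int set \<Rightarrow> (int \<Rightarrow> complex) \<Rightarrow> bool" where
  "partial_character q H chi \<longleftrightarrow>
     1 \<in> H \<and> (\<forall>n\<in>H. coprime n (int q) \<and> chi n \<noteq> 0) \<and>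
     (\<forall>m\<in>H. \<forall>n\<in>H. m * n \<in> H \<and> chi (m * n) = chi m * chi n) \<and>
     (\<forall>m\<in>H. \<forall>n. [n = m] (mod int q) \<longrightarrow> n \<in> H \<and> chi n = chi m)"

lemma partial_character_power:
  assumes "partial_character q H chi" "h \<in> H"
  shows "h ^ k \<in> H \<and> chi (h ^ k) = chi h ^ k"
proof (induction k)
  case 0
  have "chi (1 * 1) = chi 1 * chi 1" "chi 1 \<noteq> 0"
    using assms(1) unfolding partial_character_def by blast+
  then show ?case using assms(1) by (simp add: partial_character_def)
next
  case (Suc k)
  then have "h * h ^ k \<in> H \<and> chi (h * h ^ k) = chi h * chi (h ^ k)"
    using assms unfolding partial_character_def by blast
  then show ?case using Suc by simp
qed

text \<open>The power \<open>h ^ (totient q - 1)\<close> is an inverse of \<open>h\<close> modulo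
  \<open>q\<close> and belongs to \<open>H\<close>.\<close>

lemma partial_character_cancel:
  assumes pc: "partial_character q H chi" and q: "q > 0" and h: "h \<in> H" and hy: "h * y \<in> H"
  shows "y \<in> H \<and> chi (h * y) = chi h * chi y"
proof -
  define h' where "h' = h ^ (totient q - 1)"
  have "h' \<in> H" using partial_character_power[OF pc h] by (simp add: h'_def)
  have "h' * h = h ^ totient q"
    using q by (simp add: h'_def power_Suc2[symmetric] del: power_Suc power_Suc2)
  moreover have "[h ^ totient q = 1] (mod int q)"
    using euler_theorem_int[OF q] pc h by (simp add: partial_character_def)
  ultimately have "[h' * h * y = 1 * y] (mod int q)" by (intro cong_mult) simp_all
  then have "[y = h' * (h * y)] (mod int q)" by (simp add: mult.assoc cong_sym)
  moreover have "h' * (h * y) \<in> H" using pc \<open>h' \<in> H\<close> hy by (simp add: partial_character_def)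
  ultimately have "y \<in> H" using pc unfolding partial_character_def by blast
  then show ?thesis using pc h unfolding partial_character_def by blast
qed

text \<open>Only \<open>z = 1\<close> needs care, where a primitive root of unity serves; for any
  other \<open>z\<close> no root can be 1. Avoiding 1 is what later lets an extended character
  separate \<open>x\<close> from 1.\<close>

lemma exists_complex_root_ne_1:
  assumes "k > 0" "z \<noteq> 0"
  shows "\<exists>w::complex. w ^ k = z \<and> (k > 1 \<longrightarrow> w \<noteq> 1)"
proof (cases "z = 1")
  case True
  have "cis (2 * pi / real k) ^ k = 1" using ee_power[of k 1 k] ee_eq_1_iff[of k "int k"] assms(1) by (simp add: ee_def)
  moreover have "cis (2 * pi / real k) \<noteq> 1" if "k > 1"
    using ee_eq_1_iff[of k 1] that by (simp add: ee_def)
  ultimately show ?thesis using True by blast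
next
  case False
  have "exp (Ln z / of_nat k) ^ k = z"
    using assms by (simp add: exp_of_nat_mult[symmetric])
  then show ?thesis using False by (metis power_one)
qed

text \<open>The value at \<open>x\<close> can be any \<open>k\<close>-th root of \<open>chi (x ^ k)\<close>, where \<open>k\<close> is the order of \<open>x\<close> modulo \<open>H\<close>.\<close>

lemma partial_character_extend:
  assumes pc: "partial_character q H chi" and q: "q > 0" and x: "coprime x (int q)"
  shows "\<exists>H' chi'. partial_character q H' chi' \<and> H \<subseteq> H' \<and> x \<in> H' \<and>
    (\<forall>n\<in>H. chi' n = chi n) \<and> (x \<notin> H \<longrightarrow> chi' x \<noteq> 1)"
proof -
  have cop: "\<And>n. n \<in> H \<Longrightarrow> coprime n (int q)" and nz: "\<And>n. n \<in> H \<Longrightarrow> chi n \<noteq> 0"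
    and mem: "\<And>m n. m \<in> H \<Longrightarrow> n \<in> H \<Longrightarrow> m * n \<in> H"
    and mult: "\<And>m n. m \<in> H \<Longrightarrow> n \<in> H \<Longrightarrow> chi (m * n) = chi m * chi n"
    and cong: "\<And>m n. m \<in> H \<Longrightarrow> [n = m] (mod int q) \<Longrightarrow> n \<in> H \<and> chi n = chi m"
    and one: "1 \<in> H"
    using pc unfolding partial_character_def by blast+
  have chi1: "chi 1 = 1" using partial_character_power[OF pc one, of 0] by simp
  define k where "k = (LEAST k. k > 0 \<and> x ^ k \<in> H)"
  have "x ^ totient q \<in> H" using cong[OF one euler_theorem_int[OF q x]] by simp
  then have "\<exists>k. k > 0 \<and> x ^ k \<in> H" using q by (intro exI[of _ "totient q"]) simp
  then have k: "k > 0 \<and> x ^ k \<in> H" unfolding k_def by (rule LeastI_ex)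
  have kmin: "k \<le> m" if "m > 0" "x ^ m \<in> H" for m
    unfolding k_def by (rule Least_le) (use that in blast)
  obtain w where w: "w ^ k = chi (x ^ k)" "k > 1 \<Longrightarrow> w \<noteq> 1"
    using exists_complex_root_ne_1[of k "chi (x ^ k)"] k nz by blast
  have w0: "w \<noteq> 0" using w(1) k nz[of "x ^ k"] by (metis power_0_left neq0_conv)
  \<comment> \<open>Minimality of \<open>k\<close> makes it divide every exponent \<open>m\<close>
    with \<open>x ^ m\<close> in \<open>H\<close>, so the one choice of \<open>w\<close> fits all
    these powers.\<close>
  have pw: "w ^ m = chi (x ^ m)" if m: "x ^ m \<in> H" for m
  proof -
    have e: "x ^ m = (x ^ k) ^ (m div k) * x ^ (m mod k)"
      by (simp flip: power_mult power_add)
    have p: "(x ^ k) ^ (m div k) \<in> H" "chi ((x ^ k) ^ (m div k)) = chi (x ^ k) ^ (m div k)"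
      using partial_character_power[OF pc conjunct2[OF k]] by blast+
    have "x ^ (m mod k) \<in> H"
      using partial_character_cancel[OF pc q p(1), of "x ^ (m mod k)"] m unfolding e by blast
    then have "m mod k = 0" using kmin[of "m mod k"] k by (meson mod_less_divisor not_less neq0_conv)
    then have "m = k * (m div k)" by auto
    then have "w ^ m = (w ^ k) ^ (m div k)" by (metis power_mult)
    then show ?thesis using p(2) w(1) e \<open>m mod k = 0\<close> by simp
  qed
  \<comment> \<open>Well-definedness of the extension: cancelling the unit \<open>x ^ i\<close> puts
    \<open>x ^ (j - i)\<close> into \<open>H\<close>, where \<open>pw\<close> gives its
    value.\<close>
  have wd1: "chi h * w ^ i = chi h' * w ^ j"
    if h: "h \<in> H" "h' \<in> H" and c: "[h * x ^ i = h' * x ^ j] (mod int q)" and "i \<le> j" for h h' i j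
  proof -
    have "[h * x ^ i = h' * x ^ (j - i) * x ^ i] (mod int q)"
      using c \<open>i \<le> j\<close> by (simp add: mult.assoc flip: power_add)
    then have "[h' * x ^ (j - i) = h] (mod int q)"
      using x by (simp add: cong_mult_rcancel cong_sym_eq)
    then have *: "h' * x ^ (j - i) \<in> H" "chi (h' * x ^ (j - i)) = chi h" using cong[OF h(1)] by blast+
    then have "chi h = chi h' * w ^ (j - i)"
      using partial_character_cancel[OF pc q h(2) *(1)] pw by metis
    then show ?thesis using \<open>i \<le> j\<close> by (simp add: mult.assoc flip: power_add)
  qed
  have wd: "chi h * w ^ i = chi h' * w ^ j"
    if "h \<in> H" "h' \<in> H" "[h * x ^ i = h' * x ^ j] (mod int q)" for h h' i j
    using wd1[of h h' i j] wd1[of h' h j i] that by (metis cong_sym linorder_le_cases)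
  define H' where "H' = {n. \<exists>h\<in>H. \<exists>i. [n = h * x ^ i] (mod int q)}"
  define chi' where "chi' n = (SOME v. \<exists>h\<in>H. \<exists>i. [n = h * x ^ i] (mod int q) \<and> v = chi h * w ^ i)" for n
  have key: "chi' n = chi h * w ^ i" if h: "h \<in> H" "[n = h * x ^ i] (mod int q)" for n h i
  proof -
    have "\<exists>h\<in>H. \<exists>i. [n = h * x ^ i] (mod int q) \<and> chi' n = chi h * w ^ i"
      unfolding chi'_def by (rule someI) (use h in blast)
    then show ?thesis using h wd by (metis cong_sym cong_trans)
  qed
  have "partial_character q H' chi'"
    unfolding partial_character_def
  proof (intro conjI ballI allI impI)
    show "1 \<in> H'" unfolding H'_def using one by (auto intro!: bexI[of _ 1] exI[of _ 0])
    fix m assume "m \<in> H'"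
    then obtain h i where h: "h \<in> H" "[m = h * x ^ i] (mod int q)" unfolding H'_def by blast
    have "coprime (h * x ^ i) (int q)" using cop[OF h(1)] x by simp
    then show "coprime m (int q)" using h(2) by (metis cong_imp_coprime cong_sym)
    show "chi' m \<noteq> 0" using key[OF h] nz[OF h(1)] w0 by simp
    show "n \<in> H'" "chi' n = chi' m" if "[n = m] (mod int q)" for n
      using cong_trans[OF that h(2)] key h unfolding H'_def by (auto intro!: bexI[of _ h])
    fix n assume "n \<in> H'"
    then obtain h' j where h': "h' \<in> H" "[n = h' * x ^ j] (mod int q)" unfolding H'_def by blast
    have "[m * n = (h * h') * x ^ (i + j)] (mod int q)"
      using cong_mult[OF h(2) h'(2)] by (simp add: power_add mult_ac)
    note * = mem[OF h(1) h'(1)] this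
    show "m * n \<in> H'" using * unfolding H'_def by blast
    show "chi' (m * n) = chi' m * chi' n"
      using mult[OF h(1) h'(1)] by (simp add: key[OF *] key[OF h] key[OF h'] power_add)
  qed
  moreover have "H \<subseteq> H'" unfolding H'_def by (auto intro!: exI[of _ 0] bexI)
  moreover have "x \<in> H'" unfolding H'_def using one by (auto intro!: exI[of _ 1] bexI[of _ 1])
  moreover have "chi' n = chi n" if "n \<in> H" for n using key[OF that, of n 0] by simp
  moreover have "chi' x \<noteq> 1" if "x \<notin> H"
  proof -
    have "k \<noteq> 1" using k that by auto
    then show ?thesis using key[OF one, of x 1] w(2) k by (simp add: chi1)
  qed
  ultimately show ?thesis by blast
qed

text \<open>Among the partial characters with a value other than 1 at \<open>a\<close>, one with the
  largest domain is defined on all units, since otherwise it could be extended by a missing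
  unit.\<close>

lemma characters_separate:
  assumes q: "q > 0" and a: "coprime a (int q)" "\<not> [a = 1] (mod int q)"
  shows "\<exists>chi. dirichlet_character q chi \<and> chi a \<noteq> 1"
proof -
  \<comment> \<open>\<open>H\<close> itself is infinite, so its size is measured by the
    representatives in \<open>{0..<int q}\<close>; this also bounds \<open>m\<close> and makes a
    maximum exist.\<close>
  define P where "P m \<longleftrightarrow> (\<exists>H chi. partial_character q H chi \<and> a \<in> H \<and> chi a \<noteq> 1 \<and>
    card (H \<inter> {0..<int q}) = m)" for m
  have "partial_character q {n. [n = 1] (mod int q)} (\<lambda>_. 1)"
    unfolding partial_character_def
  proof (intro conjI ballI allI impI; (elim CollectE)?)
    show "coprime n (int q)" if "[n = 1] (mod int q)" for n
      using that by (metis cong_imp_coprime cong_sym coprime_1_left)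
  qed (auto dest: cong_mult cong_trans)
  \<comment> \<open>The trivial character on the class of 1 is extended to \<open>a\<close>. As
    \<open>a\<close> lies outside that class, the extension takes a value other than 1
    there.\<close>
  then obtain m0 where "P m0"
    using partial_character_extend[OF _ q a(1)] a(2) unfolding P_def by blast
  moreover have "\<forall>m. P m \<longrightarrow> m < Suc (card {0..<int q})"
    unfolding P_def less_Suc_eq_le using card_mono[of "{0..<int q}" "_ \<inter> {0..<int q}"] by blast
  ultimately have "\<exists>m. P m \<and> (\<forall>m'. P m' \<longrightarrow> m' \<le> m)"
    by (rule ex_has_greatest_nat[of P m0 "\<lambda>x. x"])
  then obtain m where m: "P m" "\<And>m'. P m' \<Longrightarrow> m' \<le> m" by blast
  then obtain H chi where H: "partial_character q H chi" "a \<in> H" "chi a \<noteq> 1"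
      and card: "card (H \<inter> {0..<int q}) = m" unfolding P_def by blast
  have full: "n \<in> H" if n: "coprime n (int q)" for n
  proof (rule ccontr)
    assume "n \<notin> H"
    obtain H' chi' where H': "partial_character q H' chi'" "H \<subseteq> H'" "n \<in> H'" "\<forall>n\<in>H. chi' n = chi n"
      using partial_character_extend[OF H(1) q n] by blast
    have "[n mod int q = n] (mod int q)" by simp
    then have "n mod int q \<in> H'" "n mod int q \<notin> H"
      using H'(1,3) H(1) \<open>n \<notin> H\<close> unfolding partial_character_def by (metis cong_sym)+
    then have "H \<inter> {0..<int q} \<subset> H' \<inter> {0..<int q}" using H'(2) q by (auto intro: pos_mod_bound)
    then have "m < card (H' \<inter> {0..<int q})" unfolding card[symmetric] by (intro psubset_card_mono) auto
    moreover have "P (card (H' \<inter> {0..<int q}))" unfolding P_def using H' H(2,3) by (metis subsetD)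
    ultimately show False using m(2) by fastforce
  qed
  have H_eq: "n \<in> H \<longleftrightarrow> coprime n (int q)" for n
    using full H(1) unfolding partial_character_def by blast
  have nz: "\<And>n. n \<in> H \<Longrightarrow> chi n \<noteq> 0"
    and mem: "\<And>m n. m \<in> H \<Longrightarrow> n \<in> H \<Longrightarrow> chi (m * n) = chi m * chi n"
    and cong: "\<And>m n. m \<in> H \<Longrightarrow> [n = m] (mod int q) \<Longrightarrow> chi n = chi m"
    using H(1) unfolding partial_character_def by blast+
  define psi where "psi n = (if coprime n (int q) then chi n else 0)" for n
  have "dirichlet_character q psi"
    unfolding dirichlet_character_def
  proof (intro conjI allI)
    show "psi (m * n) = psi m * psi n" for m n
      using mem nz by (auto simp: psi_def H_eq)
    show "psi n \<noteq> 0 \<longleftrightarrow> coprime n (int q)" for n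
      using mem nz by (auto simp: psi_def H_eq)
    have "[n + int q = n] (mod int q)" for n by (simp add: cong_def)
    moreover have "coprime (n + int q) (int q) \<longleftrightarrow> coprime n (int q)" for n
      by (simp add: coprime_iff_gcd_eq_1)
    ultimately show "psi (n + int q) = psi n" for n
      unfolding psi_def using cong[of n "n + int q"] H_eq by presburger
  qed (fact q)
  moreover have "psi a \<noteq> 1" using H a(1) by (simp add: psi_def)
  ultimately show ?thesis by blast
qed

section \<open>Orthogonality relations and Parseval's identity\<close>

lemma coprime_add_right_self_iff: "coprime (n + q) q \<longleftrightarrow> coprime n (q :: int)"
  by (simp only: coprime_iff_gcd_eq_1 gcd_add1)

lemma dirichlet_character_principal: "q > 0 \<Longrightarrow> dirichlet_character q (principal_character q)"
  unfolding dirichlet_character_def principal_character_def coprime_add_right_self_iff by auto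

lemma char_mult_bij:
  assumes chi: "dirichlet_character q chi"
  shows "bij_betw (\<lambda>psi n. chi n * psi n) {psi. dirichlet_character q psi} {psi. dirichlet_character q psi}"
proof (rule bij_betw_byWitness[where f' = "\<lambda>psi n. cnj (chi n) * psi n"])
  have "cnj (chi n) * (chi n * psi n) = psi n" "chi n * (cnj (chi n) * psi n) = psi n"
    if "dirichlet_character q psi" for psi n
  proof -
    have "cnj (chi n) * chi n * psi n = psi n"
      using cnj_char_mult[OF chi, of n] char_eq_0_iff[OF that, of n] by (cases "coprime n (int q)") simp_all
    then show "cnj (chi n) * (chi n * psi n) = psi n" "chi n * (cnj (chi n) * psi n) = psi n"
      by (simp_all only: mult_ac)
  qed
  then show "\<forall>psi\<in>{psi. dirichlet_character q psi}. (\<lambda>n. cnj (chi n) * (chi n * psi n)) = psi"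
    "\<forall>psi\<in>{psi. dirichlet_character q psi}. (\<lambda>n. chi n * (cnj (chi n) * psi n)) = psi"
    by auto
next
  show "(\<lambda>psi n. chi n * psi n) ` {psi. dirichlet_character q psi} \<subseteq> {psi. dirichlet_character q psi}"
    using dirichlet_character_mult[OF chi _ dvd_refl] by blast
  show "(\<lambda>psi n. cnj (chi n) * psi n) ` {psi. dirichlet_character q psi} \<subseteq> {psi. dirichlet_character q psi}"
    using dirichlet_character_mult[OF dirichlet_character_cnj[OF chi] _ dvd_refl] by blast
qed

lemma sum_characters_eq_0:
  assumes q: "q > 0" and a: "coprime a (int q)" "\<not> [a = 1] (mod int q)"
  shows "(\<Sum>psi | dirichlet_character q psi. psi a) = 0"
proof -
  obtain chi where chi: "dirichlet_character q chi" "chi a \<noteq> 1"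
    using characters_separate[OF assms] by blast
  have "(\<Sum>psi | dirichlet_character q psi. psi a) = (\<Sum>psi | dirichlet_character q psi. chi a * psi a)"
    using sum.reindex_bij_betw[OF char_mult_bij[OF chi(1)], of "\<lambda>psi. psi a"] by simp
  also have "\<dots> = chi a * (\<Sum>psi | dirichlet_character q psi. psi a)" by (simp add: sum_distrib_left)
  finally show ?thesis using chi(2) by simp
qed

text \<open>For modulus 1 this is \<open>{0}\<close>, whereas \<open>totatives 1\<close> is
  \<open>{1}\<close>; hence the case split in \<open>card_coprime_residues\<close>. The residue 0 is
  wanted for \<open>j = 0\<close> in \<open>sum_residues_by_gcd\<close>.\<close>

definition coprime_residues :: "nat \<Rightarrow> int set" where
  "coprime_residues d = {a. a \<in> {0..<int d} \<and> coprime a (int d)}"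

lemma finite_coprime_residues [simp]: "finite (coprime_residues d)"
  unfolding coprime_residues_def by (rule finite_subset[of _ "{0..<int d}"]) auto

lemma sum_coprime_residues:
  "(\<Sum>a\<in>coprime_residues d. f a) = (\<Sum>a\<in>{0..<int d}. if coprime a (int d) then f a else 0)"
  unfolding coprime_residues_def by (rule sum.inter_filter) simp

lemma sum_coprime_residues_mult:
  fixes f :: "int \<Rightarrow> 'a :: comm_monoid_add"
  assumes "d > 0" "coprime u (int d)" and per: "\<And>m n. [m = n] (mod int d) \<Longrightarrow> f m = f n"
  shows "(\<Sum>a\<in>coprime_residues d. f (u * a)) = (\<Sum>a\<in>coprime_residues d. f a)"
proof -
  have "(\<Sum>a\<in>{0..<int d}. if coprime (u * a) (int d) then f (u * a) else 0) =
      (\<Sum>a\<in>{0..<int d}. if coprime a (int d) then f a else 0)"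
    using assms(1,2)
  proof (rule sum_residues_mult)
    fix m n assume "[m = n] (mod int d)"
    then show "(if coprime m (int d) then f m else 0) = (if coprime n (int d) then f n else 0)"
      using per cong_imp_coprime cong_sym by (metis (full_types))
  qed
  then show ?thesis using assms(2) by (simp add: sum_coprime_residues)
qed

lemma card_coprime_residues:
  assumes "q > 0"
  shows "card (coprime_residues q) = totient q"
proof (cases "q = 1")
  case False
  have "bij_betw int (totatives q) (coprime_residues q)"
  proof (rule bij_betw_byWitness[where f' = nat])
    show "int ` totatives q \<subseteq> coprime_residues q"
      using totatives_less[of _ q] False assms by (auto simp: coprime_residues_def totatives_def)
    show "nat ` coprime_residues q \<subseteq> totatives q"
    proof (rule image_subsetI)
      fix n assume "n \<in> coprime_residues q"
      then have n: "n \<in> {0..<int q}" "coprime n (int q)" by (auto simp: coprime_residues_def)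
      have "n \<noteq> 0" using n(2) False by auto
      moreover have "coprime (nat n) q" using n by (metis atLeastLessThan_iff coprime_int_iff nat_0_le)
      ultimately show "nat n \<in> totatives q" using n(1) by (auto simp: in_totatives_iff)
    qed
  qed (auto simp: coprime_residues_def)
  then show ?thesis unfolding totient_def by (rule bij_betw_same_card[symmetric])
next
  case True
  then have "coprime_residues q = {0}" by (auto simp: coprime_residues_def)
  then show ?thesis using True by simp
qed

lemma sum_nontrivial_char:
  assumes psi: "dirichlet_character q psi" and u: "coprime u (int q)" "psi u \<noteq> 1"
  shows "(\<Sum>n\<in>{0..<int q}. psi n) = 0"
proof -
  have "(\<Sum>n\<in>{0..<int q}. psi (u * n)) = (\<Sum>n\<in>{0..<int q}. psi n)"
    by (rule sum_residues_mult[OF char_modulus_pos[OF psi] u(1) dirichlet_character_cong[OF psi]])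
  then show ?thesis using u(2) by (simp add: char_mult[OF psi] flip: sum_distrib_left)
qed

text \<open>Double counting of the sum of \<open>psi n\<close> over all characters and units:
  summing over \<open>n\<close> first leaves only the principal character, summing over
  \<open>psi\<close> first leaves only the class of 1.\<close>

lemma card_characters:
  assumes q: "q > 0"
  shows "card {psi. dirichlet_character q psi} = totient q"
proof -
  let ?X = "{psi. dirichlet_character q psi}" and ?A = "coprime_residues q"
  have 1: "(\<Sum>n\<in>?A. psi n) = (if psi = principal_character q then of_nat (totient q) else 0)"
    if "psi \<in> ?X" for psi
  proof (cases "psi = principal_character q")
    case True
    then have "(\<Sum>n\<in>?A. psi n) = (\<Sum>n\<in>?A. 1)"
      by (intro sum.cong) (auto simp: coprime_residues_def principal_character_def)
    then show ?thesis using True card_coprime_residues[OF q] by simp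
  next
    case False
    then obtain u where "psi u \<noteq> principal_character q u" by blast
    then have "coprime u (int q)" "psi u \<noteq> 1"
      using that char_eq_0_iff[of q psi u] by (auto simp: principal_character_def split: if_splits)
    moreover have "(\<Sum>n\<in>?A. psi n) = (\<Sum>n\<in>{0..<int q}. psi n)"
      using that by (intro sum.mono_neutral_left) (auto simp: coprime_residues_def char_eq_0_iff)
    ultimately show ?thesis using that False sum_nontrivial_char[of q psi u] by simp
  qed
  \<comment> \<open>The representative of 1 is written \<open>1 mod int q\<close> because for
    \<open>q = 1\<close> it is 0.\<close>
  have 2: "(\<Sum>psi\<in>?X. psi n) = (if n = 1 mod int q then of_nat (card ?X) else 0)" if "n \<in> ?A" for n
  proof (cases "n = 1 mod int q")
    case True
    then have "psi n = 1" if "psi \<in> ?X" for psi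
      using that dirichlet_character_cong[of q psi n 1] char_one[of q psi] by (simp add: cong_def)
    then have "(\<Sum>psi\<in>?X. psi n) = (\<Sum>psi\<in>?X. 1)" by (rule sum.cong[OF refl])
    then show ?thesis using True by simp
  next
    case False
    then have "\<not> [n = 1] (mod int q)" "coprime n (int q)"
      using that by (auto simp: coprime_residues_def cong_def)
    then show ?thesis using False sum_characters_eq_0[OF q, of n] by simp
  qed
  have "1 mod int q \<in> ?A" using q by (simp add: coprime_residues_def)
  then have "of_nat (card ?X) = (\<Sum>n\<in>?A. if n = 1 mod int q then of_nat (card ?X) else (0 :: complex))"
    by (subst sum.delta[OF finite_coprime_residues]) auto
  also have "\<dots> = (\<Sum>n\<in>?A. \<Sum>psi\<in>?X. psi n)"
    by (intro sum.cong refl 2[symmetric])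
  also have "\<dots> = (\<Sum>psi\<in>?X. \<Sum>n\<in>?A. psi n)" by (rule sum.swap)
  also have "\<dots> = (\<Sum>psi\<in>?X. if psi = principal_character q then of_nat (totient q) else 0)"
    by (intro sum.cong refl 1)
  also have "\<dots> = of_nat (totient q)"
    using finite_dirichlet_characters[of q] dirichlet_character_principal[OF q]
    by (subst sum.delta) auto
  finally show ?thesis by (simp only: of_nat_eq_iff)
qed

text \<open>The conjugate of \<open>psi b\<close> is \<open>psi\<close> at an inverse of
  \<open>b\<close>, so after expanding the squares the sum over \<open>psi\<close> retains exactly
  the terms with \<open>a = b\<close>.\<close>

lemma parseval_characters:
  fixes f :: "int \<Rightarrow> complex"
  assumes q: "q > 0"
  shows "(\<Sum>psi | dirichlet_character q psi. (cmod (\<Sum>a\<in>coprime_residues q. psi a * f a))\<^sup>2) =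
    real (totient q) * (\<Sum>a\<in>coprime_residues q. (cmod (f a))\<^sup>2)"
proof -
  let ?X = "{psi. dirichlet_character q psi}"
  have orth: "(\<Sum>psi\<in>?X. psi a * cnj (psi b)) = (if a = b then of_nat (totient q) else 0)"
    if "a \<in> coprime_residues q" "b \<in> coprime_residues q" for a b
  proof -
    have b: "coprime b (int q)" using that by (simp add: coprime_residues_def)
    obtain v where v: "[b * v = 1] (mod int q)" "coprime v (int q)" using inverse_mod_int[OF b] .
    have "cnj (psi b) = psi v" if "psi \<in> ?X" for psi
    proof -
      have psi: "dirichlet_character q psi" using that by simp
      have "psi b * psi v = 1"
        using dirichlet_character_cong[OF psi v(1)] by (simp add: char_mult[OF psi] char_one[OF psi])
      then show ?thesis using cnj_char_mult[OF psi b] by (metis mult.assoc mult.right_neutral mult_1)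
    qed
    then have *: "(\<Sum>psi\<in>?X. psi a * cnj (psi b)) = (\<Sum>psi\<in>?X. psi (a * v))"
      by (intro sum.cong) (auto simp: char_mult)
    show ?thesis
    proof (cases "a = b")
      case True
      then have "psi (a * v) = 1" if "psi \<in> ?X" for psi
        using that dirichlet_character_cong[of q psi _ 1] v(1) char_one[of q psi] by simp
      then have "(\<Sum>psi\<in>?X. psi (a * v)) = (\<Sum>psi\<in>?X. 1)" by (rule sum.cong[OF refl])
      then show ?thesis using True card_characters[OF q] unfolding * by simp
    next
      case False
      have "\<not> [a * v = 1] (mod int q)"
      proof
        assume "[a * v = 1] (mod int q)"
        then have "[a * v = b * v] (mod int q)" using v(1) by (metis cong_sym cong_trans)
        then have "[a = b] (mod int q)" using v(2) by (simp add: cong_mult_rcancel)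
        then show False using that False by (simp add: coprime_residues_def cong_def)
      qed
      moreover have "coprime (a * v) (int q)" using that v(2) by (simp add: coprime_residues_def)
      ultimately show ?thesis using False by (simp add: * sum_characters_eq_0[OF q])
    qed
  qed
  have "complex_of_real (\<Sum>psi\<in>?X. (cmod (\<Sum>a\<in>coprime_residues q. psi a * f a))\<^sup>2) =
      (\<Sum>psi\<in>?X. (\<Sum>a\<in>coprime_residues q. psi a * f a) * (\<Sum>b\<in>coprime_residues q. cnj (psi b) * cnj (f b)))"
    by (simp only: of_real_sum complex_norm_square cnj_sum complex_cnj_mult)
  also have "\<dots> = (\<Sum>psi\<in>?X. \<Sum>a\<in>coprime_residues q. \<Sum>b\<in>coprime_residues q. f a * cnj (f b) * (psi a * cnj (psi b)))"
    by (simp add: sum_product mult_ac)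
  also have "\<dots> = (\<Sum>a\<in>coprime_residues q. \<Sum>psi\<in>?X. \<Sum>b\<in>coprime_residues q. f a * cnj (f b) * (psi a * cnj (psi b)))"
    by (rule sum.swap)
  also have "\<dots> = (\<Sum>a\<in>coprime_residues q. \<Sum>b\<in>coprime_residues q. \<Sum>psi\<in>?X. f a * cnj (f b) * (psi a * cnj (psi b)))"
    by (rule sum.cong[OF refl], rule sum.swap)
  also have "\<dots> = (\<Sum>a\<in>coprime_residues q. \<Sum>b\<in>coprime_residues q. if a = b then f a * cnj (f b) * of_nat (totient q) else 0)"
    by (intro sum.cong refl) (simp add: orth flip: sum_distrib_left)
  also have "\<dots> = (\<Sum>a\<in>coprime_residues q. f a * cnj (f a) * of_nat (totient q))"
    by (simp add: sum.delta)
  also have "\<dots> = complex_of_real (real (totient q) * (\<Sum>a\<in>coprime_residues q. (cmod (f a))\<^sup>2))"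
    by (simp only: of_real_mult of_real_sum complex_norm_square sum_distrib_left of_real_of_nat_eq mult_ac)
  finally show ?thesis by (simp only: of_real_eq_iff)
qed

section \<open>The sine series of the sawtooth function\<close>

lemma dirichlet_kernel:
  fixes t :: real
  shows "2 * sin (t / 2) * (\<Sum>n<N. cos (real (Suc n) * t)) = sin ((real N + 1 / 2) * t) - sin (t / 2)"
proof (induction N)
  case (Suc N)
  have "2 * sin (t / 2) * cos (real (Suc N) * t) =
      sin (t / 2 + real (Suc N) * t) + sin (t / 2 - real (Suc N) * t)"
    by (simp add: sin_add sin_diff)
  also have "t / 2 + real (Suc N) * t = (real (Suc N) + 1 / 2) * t" by (simp add: field_simps)
  also have "t / 2 - real (Suc N) * t = - ((real N + 1 / 2) * t)" by (simp add: field_simps)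
  finally show ?case using Suc by (simp add: ring_distribs(1))
qed simp

text \<open>The cosine term makes the derivative of the error \<open>R N\<close> of size \<open>O(1 / N)\<close>, and \<open>R N\<close> vanishes at \<open>pi\<close>, so
  the mean value theorem replaces the Riemann--Lebesgue lemma.\<close>

lemma sawtooth_series_aux:
  fixes \<theta> :: real
  assumes \<theta>: "0 < \<theta>" "\<theta> \<le> pi"
  shows "(\<lambda>n. sin (real (Suc n) * \<theta>) / real (Suc n)) sums ((pi - \<theta>) / 2)"
proof (cases "\<theta> = pi")
  case True
  have "sin (real (Suc n) * pi) = 0" for n by (rule sin_npi)
  then show ?thesis using True by (simp only: div_0 sums_zero diff_self)
next
  case False
  define S where "S N t = (\<Sum>n<N. sin (real (Suc n) * t) / real (Suc n))" for N and t :: real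
  define M where "M N = real N + 1 / 2" for N
  \<comment> \<open>By the Dirichlet kernel, \<open>S N t - (pi - t) / 2\<close> has derivative
    \<open>sin (M N * t) / (2 * sin (t / 2))\<close>. The added term is minus the leading part of
    its antiderivative; after cancellation only the derivative of \<open>1 / sin (t / 2)\<close>
    survives, with a factor \<open>1 / M N\<close>.\<close>
  define R where "R N t = S N t - (pi - t) / 2 + cos (M N * t) / (2 * M N * sin (t / 2))" for N t
  define s where "s = sin (\<theta> / 2)"
  have M: "M N > 0" for N by (simp add: M_def)
  have s: "s > 0" unfolding s_def using \<theta> by (intro sin_gt_zero) auto
  have bound: "\<bar>R N \<theta>\<bar> \<le> (pi - \<theta>) / (4 * M N * s\<^sup>2)" for N
  proof -
    have der: "(R N has_real_derivative - cos (M N * t) * cos (t / 2) / (4 * M N * (sin (t / 2))\<^sup>2)) (at t)"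
      if "\<theta> \<le> t" "t \<le> pi" for t
    proof -
      have st: "sin (t / 2) > 0" using that \<theta> by (intro sin_gt_zero) auto
      have d: "(R N has_real_derivative (\<Sum>n<N. cos (real (Suc n) * t)) + 1 / 2 +
          (- (sin (M N * t) * M N) * (2 * M N * sin (t / 2)) - cos (M N * t) * (M N * cos (t / 2))) /
            (2 * M N * sin (t / 2))\<^sup>2) (at t)"
        unfolding R_def S_def using st M[of N]
        by (auto intro!: derivative_eq_intros simp: power2_eq_square)
      have "(\<Sum>n<N. cos (real (Suc n) * t)) = sin (M N * t) / (2 * sin (t / 2)) - 1 / 2"
        using dirichlet_kernel[of t N] st unfolding M_def by (simp add: field_simps)
      then have "(\<Sum>n<N. cos (real (Suc n) * t)) + 1 / 2 +
          (- (sin (M N * t) * M N) * (2 * M N * sin (t / 2)) - cos (M N * t) * (M N * cos (t / 2))) /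
            (2 * M N * sin (t / 2))\<^sup>2 = - cos (M N * t) * cos (t / 2) / (4 * M N * (sin (t / 2))\<^sup>2)"
        using st M[of N] by (simp add: field_simps power2_eq_square)
      then show ?thesis using d by simp
    qed
    obtain z where z: "\<theta> < z" "z < pi"
      "R N pi - R N \<theta> = (pi - \<theta>) * (- cos (M N * z) * cos (z / 2) / (4 * M N * (sin (z / 2))\<^sup>2))"
      using MVT2[of \<theta> pi "R N", OF _ der] \<theta> False by auto
    \<comment> \<open>The half in \<open>M N\<close> makes \<open>M N * pi\<close> an odd multiple
      of \<open>pi / 2\<close>, so the correcting cosine vanishes at \<open>pi\<close> together with
      all the sines.\<close>
    have "S N pi = 0" unfolding S_def by (rule sum.neutral) (metis div_0 sin_npi)
    moreover have "cos (M N * pi) = 0"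
      using cos_zero_iff_int2 by (auto simp: M_def ring_distribs intro!: exI[of _ "int N"] simp flip: of_nat_Suc)
    ultimately have "R N pi = 0" by (simp add: R_def)
    then have "\<bar>R N \<theta>\<bar> = (pi - \<theta>) * (\<bar>cos (M N * z)\<bar> * \<bar>cos (z / 2)\<bar>) / (4 * M N * (sin (z / 2))\<^sup>2)"
      using z \<theta> M[of N] by (simp add: abs_mult)
    also have "\<dots> \<le> (pi - \<theta>) * (1 * 1) / (4 * M N * s\<^sup>2)"
    proof (rule frac_le)
      show "(pi - \<theta>) * (\<bar>cos (M N * z)\<bar> * \<bar>cos (z / 2)\<bar>) \<le> (pi - \<theta>) * (1 * 1)"
        using \<theta> by (intro mult_left_mono mult_mono) auto
      have "s \<le> sin (z / 2)" unfolding s_def using z \<theta> by (intro sin_monotone_2pi_le) auto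
      then show "4 * M N * s\<^sup>2 \<le> 4 * M N * (sin (z / 2))\<^sup>2"
        using M[of N] s by (intro mult_left_mono power_mono) auto
    qed (use \<theta> M[of N] s in auto)
    finally show ?thesis by simp
  qed
  have le: "\<bar>S N \<theta> - (pi - \<theta>) / 2\<bar> \<le> (pi - \<theta>) / (4 * M N * s\<^sup>2) + 1 / (2 * M N * s)" for N
  proof -
    have "S N \<theta> - (pi - \<theta>) / 2 = R N \<theta> - cos (M N * \<theta>) / (2 * M N * s)"
      by (simp add: R_def s_def)
    moreover have "\<bar>cos (M N * \<theta>) / (2 * M N * s)\<bar> \<le> 1 / (2 * M N * s)"
      using M[of N] s by (simp add: abs_mult divide_right_mono)
    ultimately show ?thesis using bound[of N] by linarith
  qed
  have lim: "(\<lambda>N. (pi - \<theta>) / (4 * M N * s\<^sup>2) + 1 / (2 * M N * s)) \<longlonglongrightarrow> 0"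
    unfolding M_def using s by real_asymp
  have "(\<lambda>N. S N \<theta> - (pi - \<theta>) / 2) \<longlonglongrightarrow> 0"
    by (rule Lim_null_comparison[OF always_eventually lim]) (use le in simp)
  then show ?thesis unfolding sums_def S_def by (simp add: LIM_zero_iff)
qed

text \<open>At integers every sine vanishes, which matches the value 0 of \<open>B1\<close> there.
  Otherwise \<open>x\<close> is replaced by its fractional part \<open>y\<close>, and if
  \<open>y > 1/2\<close> the reflection of \<open>y\<close> to \<open>1 - y\<close>, under which
  both sides are odd, moves the angle into the range of \<open>sawtooth_series_aux\<close>.\<close>

lemma sawtooth_series:
  fixes x :: real
  shows "(\<lambda>n. sin (2 * pi * real (Suc n) * x) / real (Suc n)) sums (- pi * B1 x)"
proof (cases "x \<in> \<int>")
  case True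
  then obtain k where k: "x = of_int k" by (elim Ints_cases)
  have "sin (2 * pi * real (Suc n) * x) = 0" for n
    using sin_integer_2pi[of "real (Suc n) * x"] by (simp add: k mult.assoc)
  then show ?thesis using True by (simp add: B1_def)
next
  case False
  define y where "y = frac x"
  have y: "0 < y" "y < 1" using False frac_ge_0[of x] frac_lt_1[of x] frac_eq_0_iff[of x]
    by (auto simp: y_def less_le)
  have x: "x = y + of_int \<lfloor>x\<rfloor>" by (simp add: y_def frac_def)
  have 1: "sin (2 * pi * real (Suc n) * x) = sin (real (Suc n) * (2 * pi * y))" for n
  proof -
    have "2 * pi * real (Suc n) * x = real (Suc n) * (2 * pi * y) + of_int (int (Suc n) * \<lfloor>x\<rfloor>) * (2 * pi)"
      by (subst x) (simp add: algebra_simps)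
    then show ?thesis by (simp only: sin.plus_of_int[where 'a = real, unfolded of_real_eq_id id_apply])
  qed
  have B: "- pi * B1 x = (pi - 2 * pi * y) / 2"
    using False by (simp add: B1_def y_def frac_def field_simps)
  show ?thesis
  proof (cases "2 * pi * y \<le> pi")
    case True
    then show ?thesis unfolding 1 B using y by (intro sawtooth_series_aux) auto
  next
    case False
    have "(\<lambda>n. sin (real (Suc n) * (2 * pi - 2 * pi * y)) / real (Suc n)) sums ((pi - (2 * pi - 2 * pi * y)) / 2)"
      using y False by (intro sawtooth_series_aux) auto
    moreover have "sin (real (Suc n) * (2 * pi - 2 * pi * y)) = - sin (real (Suc n) * (2 * pi * y))" for n
    proof -
      have "real (Suc n) * (2 * pi - 2 * pi * y) = - (real (Suc n) * (2 * pi * y)) + of_int (int (Suc n)) * (2 * pi)"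
        by (simp add: algebra_simps)
      then show ?thesis by (simp only: sin.plus_of_int[where 'a = real, unfolded of_real_eq_id id_apply] sin_minus)
    qed
    moreover have "(pi - (2 * pi - 2 * pi * y)) / 2 = - ((pi - 2 * pi * y) / 2)" by (simp add: field_simps)
    ultimately have "(\<lambda>n. - (sin (real (Suc n) * (2 * pi * y)) / real (Suc n))) sums (- ((pi - 2 * pi * y) / 2))"
      by (simp only: minus_divide_left)
    from sums_minus[OF this] show ?thesis unfolding 1 B by (simp only: minus_minus)
  qed
qed

text \<open>Convergence and value in one relation: \<open>L_one\<close> alone says nothing about
  convergence, while linearity and uniqueness of limits require it.\<close>

definition Lsums :: "(int \<Rightarrow> complex) \<Rightarrow> complex \<Rightarrow> bool" where
  "Lsums f s \<longleftrightarrow> (\<lambda>n. f (int (Suc n)) / of_nat (Suc n)) sums s"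

lemma Lsums_L_one: "Lsums f s \<Longrightarrow> L_one f = s"
  unfolding Lsums_def L_one_def by (rule sums_unique[symmetric])

lemma Lsums_unique: "Lsums f s \<Longrightarrow> Lsums f s' \<Longrightarrow> s = s'"
  by (metis Lsums_L_one)

lemma Lsums_mult: "Lsums f s \<Longrightarrow> Lsums (\<lambda>l. c * f l) (c * s)"
  unfolding Lsums_def times_divide_eq_right[symmetric] by (rule sums_mult)

lemma Lsums_sum: "(\<And>i. i \<in> I \<Longrightarrow> Lsums (f i) (s i)) \<Longrightarrow> Lsums (\<lambda>l. \<Sum>i\<in>I. f i l) (\<Sum>i\<in>I. s i)"
  unfolding Lsums_def sum_divide_distrib by (rule sums_sum)

text \<open>Only the terms \<open>l = t * m\<close> survive, and the factor \<open>t\<close> cancels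
  the \<open>t\<close> in the denominator. Inserting zeros keeps the order of the terms, so
  conditional convergence suffices.\<close>

lemma Lsums_dilate:
  assumes t: "t > 0" and h: "Lsums h s"
  shows "Lsums (\<lambda>l. if int t dvd l then of_nat t * h (l div int t) else 0) s"
proof -
  define f where "f n = (if int t dvd int (Suc n) then of_nat t * h (int (Suc n) div int t) else 0) / of_nat (Suc n)" for n
  \<comment> \<open>Terms are indexed from 0 but stand for \<open>l = Suc n\<close>; the offset
    \<open>t - 1\<close> makes \<open>Suc (g m)\<close> equal to \<open>t * Suc m\<close>.\<close>
  define g where "g m = t * m + (t - 1)" for m
  have Sg: "Suc (g m) = t * Suc m" for m using t by (simp add: g_def)
  have "strict_mono g" unfolding g_def using t by (intro strict_monoI add_strict_right_mono) simp
  moreover have "f n = 0" if "n \<notin> range g" for n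
  proof -
    have "\<not> t dvd Suc n"
    proof
      assume "t dvd Suc n"
      then obtain k where k: "Suc n = t * k" by blast
      then obtain m where "k = Suc m" by (cases k) auto
      then have "n = g m" using k Sg[of m] by simp
      then show False using that by blast
    qed
    then show ?thesis by (simp only: f_def of_nat_dvd_iff if_False div_0)
  qed
  moreover have fg: "f (g m) = h (int (Suc m)) / of_nat (Suc m)" for m
    unfolding f_def Sg using t by (simp del: of_nat_Suc mult_Suc_right)
  moreover have "(\<lambda>m. f (g m)) sums s" using h unfolding Lsums_def fg .
  ultimately have "f sums s" using sums_mono_reindex by blast
  then show ?thesis unfolding Lsums_def f_def[abs_def] .
qed

lemma Lsums_sin: "Lsums (\<lambda>l. of_real (sin (2 * pi * of_int l * x))) (- of_real pi * of_real (B1 x))"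
proof -
  have "(\<lambda>n. complex_of_real (sin (2 * pi * real (Suc n) * x) / real (Suc n))) sums of_real (- pi * B1 x)"
    by (intro sums_of_real sawtooth_series)
  then show ?thesis unfolding Lsums_def by simp
qed

text \<open>Fourier inversion modulo \<open>q\<close> writes \<open>f\<close> as a finite
  combination of sines, and each of these has a convergent series by
  \<open>Lsums_sin\<close>.\<close>

lemma odd_periodic_Lsums:
  assumes q: "q > 0" and per: "\<And>m n. [m = n] (mod int q) \<Longrightarrow> f m = f n"
    and odd: "\<And>n. f (- n) = - f n"
  shows "Lsums f (L_one f)"
proof -
  define c where "c k = (\<Sum>m\<in>{0..<int q}. f m * ee q (- (m * k)))" for k
  have inv: "(\<Sum>k\<in>{0..<int q}. c k * ee q (n * k)) = of_nat q * f n" for n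
  proof -
    have "(\<Sum>k\<in>{0..<int q}. c k * ee q (n * k)) =
        (\<Sum>k\<in>{0..<int q}. \<Sum>m\<in>{0..<int q}. f m * ee q ((n - m) * k))"
      by (simp add: c_def sum_distrib_right sum_distrib_left ring_distribs mult.assoc flip: ee_add)
    also have "\<dots> = (\<Sum>m\<in>{0..<int q}. f m * (\<Sum>k\<in>{0..<int q}. ee q ((n - m) * k)))"
      by (subst sum.swap) (simp add: sum_distrib_left)
    also have "\<dots> = (\<Sum>m\<in>{0..<int q}. if m = n mod int q then f m * of_nat q else 0)"
    proof (intro sum.cong refl)
      fix m assume m: "m \<in> {0..<int q}"
      have "int q dvd n - m \<longleftrightarrow> m = n mod int q"
        using m by (auto simp: mod_eq_dvd_iff[symmetric])
      then show "f m * (\<Sum>k\<in>{0..<int q}. ee q ((n - m) * k)) = (if m = n mod int q then f m * of_nat q else 0)"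
        by (simp add: sum_ee[OF q])
    qed
    also have "\<dots> = f (n mod int q) * of_nat q" using q by (subst sum.delta) auto
    also have "f (n mod int q) = f n" by (rule per) simp
    finally show ?thesis by simp
  qed
  \<comment> \<open>Writing \<open>2 * f n\<close> as \<open>f n - f (- n)\<close> turns the
    exponentials of the inversion formula into sines.\<close>
  have fn: "f n = (\<Sum>k\<in>{0..<int q}. (\<i> * c k / of_nat q) * of_real (sin (2 * pi * of_int n * (of_int k / of_nat q))))" for n
  proof -
    have "2 * of_nat q * f n = of_nat q * f n - of_nat q * f (- n)" by (simp add: odd)
    also have "\<dots> = (\<Sum>k\<in>{0..<int q}. c k * (ee q (n * k) - ee q (- (n * k))))"
      unfolding inv[symmetric] by (simp add: sum_subtractf ring_distribs)
    also have "\<dots> = (\<Sum>k\<in>{0..<int q}. c k * (2 * \<i> * of_real (sin (2 * pi * of_int n * (of_int k / of_nat q)))))"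
      by (intro sum.cong refl arg_cong2[of _ _ _ _ times])
        (simp add: ee_minus ee_def complex_eq_iff mult.assoc)
    also have "\<dots> = 2 * of_nat q * (\<Sum>k\<in>{0..<int q}. (\<i> * c k / of_nat q) *
        of_real (sin (2 * pi * of_int n * (of_int k / of_nat q))))"
      unfolding sum_distrib_left using q by (intro sum.cong refl) (simp add: field_simps)
    finally show ?thesis using q by simp
  qed
  have "\<exists>s. Lsums f s" unfolding ext[of f, OF fn]
    by (rule exI, rule Lsums_sum, rule Lsums_mult, rule Lsums_sin)
  then obtain s where "Lsums f s" by blast
  then show ?thesis using Lsums_L_one by metis
qed

section \<open>Moebius inversion\<close>

lemma prod_prime_factors_squarefree:
  fixes k :: nat
  assumes "squarefree k"
  shows "\<Prod>(prime_factors k) = k"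
proof -
  have k: "k \<noteq> 0" using assms by (metis not_squarefree_0)
  have "(\<Prod>p\<in>prime_factors k. p ^ multiplicity p k) = \<Prod>(prime_factors k)"
    using assms k by (intro prod.cong) (auto simp: squarefree_factorial_semiring')
  then show ?thesis using prime_factorization_nat[of k] k by simp
qed

lemma prod_primes:
  fixes A :: "nat set"
  assumes "finite A" "\<And>p. p \<in> A \<Longrightarrow> prime p"
  shows "squarefree (\<Prod>A)" "prime_factors (\<Prod>A) = A"
proof -
  show "squarefree (\<Prod>A)"
    using assms(2) by (intro squarefree_prod_coprime primes_coprime squarefree_prime) auto
  have "0 \<notin> A" using assms(2) by (metis not_prime_0)
  then show "prime_factors (\<Prod>A) = A"
    using assms by (simp add: prime_factors_prod prime_prime_factors)
qed

text \<open>Squarefree divisors of \<open>n\<close> correspond to subsets of its prime factors, and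
  the signed sum over subsets expands a product of factors \<open>- 1 + 1\<close>, which is empty
  exactly for \<open>n = 1\<close>.\<close>

lemma sum_moebius_mu:
  assumes n: "n > 0"
  shows "(\<Sum>k | k dvd n. moebius_mu k) = (if n = 1 then 1 else 0)"
proof -
  let ?P = "prime_factors n"
  have primes: "\<And>A p. A \<in> Pow ?P \<Longrightarrow> p \<in> A \<Longrightarrow> prime p" by auto
  have fin: "\<And>A. A \<in> Pow ?P \<Longrightarrow> finite A" by (auto intro: finite_subset)
  have dvd: "\<Prod>A dvd n" if "A \<in> Pow ?P" for A
  proof -
    have "\<Prod>A dvd \<Prod>?P" using that by (intro prod_dvd_prod_subset) auto
    also have "\<Prod>?P dvd (\<Prod>p\<in>?P. p ^ multiplicity p n)"
      by (intro prod_dvd_prod dvd_power) (auto simp: prime_factors_multiplicity)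
    also have "\<dots> = n" using prime_factorization_nat[OF n] by simp
    finally show ?thesis .
  qed
  have "(\<Sum>k | k dvd n. moebius_mu k) = (\<Sum>k | k dvd n \<and> squarefree k. moebius_mu k)"
    using n by (intro sum.mono_neutral_right) (auto simp: moebius_mu_def)
  also have "\<dots> = (\<Sum>A\<in>Pow ?P. (- 1) ^ card A)"
  proof (rule sum.reindex_bij_witness[where i = "\<lambda>A. \<Prod>A" and j = prime_factors])
    fix k assume "k \<in> {k. k dvd n \<and> squarefree k}"
    then show "\<Prod>(prime_factors k) = k" "prime_factors k \<in> Pow ?P"
      "(- 1) ^ card (prime_factors k) = moebius_mu k"
      using n dvd_prime_factors[of n k] by (auto simp: prod_prime_factors_squarefree moebius_mu_def)
  next
    fix A assume A: "A \<in> Pow ?P"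
    show "prime_factors (\<Prod>A) = A" "\<Prod>A \<in> {k. k dvd n \<and> squarefree k}"
      using prod_primes[OF fin[OF A] primes[OF A]] dvd[OF A] by auto
  qed
  also have "\<dots> = (\<Prod>p\<in>?P. - 1 + 1)" by (subst prod_add) auto
  also have "\<dots> = (if n = 1 then 1 else 0)"
  proof (cases "n = 1")
    case False
    then have "?P \<noteq> {}" using n by (simp add: prime_factorization_empty_iff)
    then show ?thesis using False by (simp add: card_gt_0_iff zero_power)
  qed simp
  finally show ?thesis .
qed

text \<open>The indicator of coprimality is the sum of \<open>moebius_mu\<close> over the common
  divisors of \<open>a\<close> and \<open>d\<close>; after the interchange, the multiples of
  \<open>k\<close> below \<open>d\<close> are \<open>k * i\<close> with \<open>i\<close> below
  \<open>d div k\<close>.\<close>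

lemma sum_coprime_moebius:
  fixes h :: "int \<Rightarrow> complex"
  assumes d: "d > 0"
  shows "(\<Sum>a\<in>coprime_residues d. h a) =
    (\<Sum>k | k dvd d. of_int (moebius_mu k) * (\<Sum>i\<in>{0..<int (d div k)}. h (int k * i)))"
proof -
  have fin: "finite {k. k dvd d}" using d by simp
  have "(\<Sum>a\<in>coprime_residues d. h a) =
      (\<Sum>a\<in>{0..<int d}. \<Sum>k | k dvd d. if int k dvd a then of_int (moebius_mu k) * h a else 0)"
    unfolding sum_coprime_residues
  proof (intro sum.cong refl)
    fix a assume "a \<in> {0..<int d}"
    define g where "g = nat (gcd a (int d))"
    have g: "int g = gcd a (int d)" by (simp add: g_def)
    have "g > 0" using d by (simp add: g_def gcd_pos_int)
    have "{k. k dvd g} = {k \<in> {k. k dvd d}. int k dvd a}"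
      by (simp only: of_nat_dvd_iff[where 'a = int, symmetric] g gcd_greatest_iff) blast
    then have "(\<Sum>k | k dvd d. if int k dvd a then of_int (moebius_mu k) * h a else 0) =
        (\<Sum>k | k dvd g. of_int (moebius_mu k) * h a)"
      by (simp only: sum.inter_filter[OF fin])
    also have "\<dots> = of_int (\<Sum>k | k dvd g. moebius_mu k) * h a" by (simp add: sum_distrib_right)
    also have "\<dots> = (if coprime a (int d) then h a else 0)"
      using sum_moebius_mu[OF \<open>g > 0\<close>] g by (simp add: coprime_iff_gcd_eq_1 flip: of_nat_eq_1_iff)
    finally show "(if coprime a (int d) then h a else 0) =
      (\<Sum>k | k dvd d. if int k dvd a then of_int (moebius_mu k) * h a else 0)" ..
  qed
  also have "\<dots> = (\<Sum>k | k dvd d. \<Sum>a\<in>{0..<int d}. if int k dvd a then of_int (moebius_mu k) * h a else 0)"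
    by (rule sum.swap)
  also have "\<dots> = (\<Sum>k | k dvd d. of_int (moebius_mu k) * (\<Sum>i\<in>{0..<int (d div k)}. h (int k * i)))"
  proof (intro sum.cong refl)
    fix k assume "k \<in> {k. k dvd d}"
    then have k: "d = k * (d div k)" "k > 0" using d by (auto intro: Nat.gr0I)
    have "(\<Sum>a\<in>{0..<int d}. if int k dvd a then of_int (moebius_mu k) * h a else 0) =
        (\<Sum>a | a \<in> {0..<int d} \<and> int k dvd a. of_int (moebius_mu k) * h a)"
      by (rule sum.inter_filter[symmetric]) simp
    also have "\<dots> = (\<Sum>i\<in>{0..<int (d div k)}. of_int (moebius_mu k) * h (int k * i))"
    proof (rule sum.reindex_bij_witness[where i = "\<lambda>i. int k * i" and j = "\<lambda>a. a div int k"])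
      fix i assume i: "i \<in> {0..<int (d div k)}"
      then have "int k * i < int k * int (d div k)" using k(2) by simp
      then show "int k * i \<in> {a. a \<in> {0..<int d} \<and> int k dvd a}"
        using i k(1) by (metis (no_types, lifting) atLeastLessThan_iff dvd_triv_left mem_Collect_eq
          of_nat_0_le_iff of_nat_mult zero_le_mult_iff)
    next
      fix a assume a: "a \<in> {a. a \<in> {0..<int d} \<and> int k dvd a}"
      then obtain i where i: "a = int k * i" by blast
      have "int k * i < int k * int (d div k)" using a i k(1) by (metis atLeastLessThan_iff mem_Collect_eq of_nat_mult)
      then have "i < int (d div k)" using k(2) by (simp only: mult_less_cancel_left_pos of_nat_0_less_iff)
      moreover have "0 \<le> i" using a i k(2) by (simp add: zero_le_mult_iff)
      ultimately show "a div int k \<in> {0..<int (d div k)}" using i k(2) by simp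
    qed (use k(2) in auto)
    finally show "(\<Sum>a\<in>{0..<int d}. if int k dvd a then of_int (moebius_mu k) * h a else 0) =
      of_int (moebius_mu k) * (\<Sum>i\<in>{0..<int (d div k)}. h (int k * i))"
      by (simp add: sum_distrib_left)
  qed
  finally show ?thesis .
qed

text \<open>Each \<open>j\<close> is \<open>gcd(j,c)\<close> times a unit modulo \<open>d\<close>,
  where \<open>gcd(j,c) = c div d\<close>. The residue \<open>j = 0\<close> falls under
  \<open>d = 1\<close>.\<close>

lemma sum_residues_by_gcd:
  fixes h :: "int \<Rightarrow> complex"
  assumes c: "c > 0"
  shows "(\<Sum>j\<in>{0..<int c}. h j) = (\<Sum>d | d dvd c. \<Sum>j\<in>coprime_residues d. h (int (c div d) * j))"
proof -
  have pos: "d > 0" "c div d > 0" "int (c div d) * int d = int c" if "d dvd c" for d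
    using that c by (auto elim!: dvdE simp flip: of_nat_mult intro: Nat.gr0I)
  define g where "g j = nat (gcd j (int c))" for j
  have g: "int (g j) = gcd j (int c)" for j by (simp add: g_def)
  have gdvd: "g j dvd c" for j
    using gcd_dvd2[of j "int c"] unfolding g[symmetric] by (simp only: of_nat_dvd_iff)
  have g0: "g j > 0" for j using gdvd[of j] c by (auto intro: Nat.gr0I)
  have cc: "c div (c div g j) = g j" for j using gdvd[of j] c by (simp add: div_div_eq_right)
  have "(\<Sum>j\<in>{0..<int c}. h j) = (\<Sum>(d,j)\<in>(SIGMA d:{d. d dvd c}. coprime_residues d). h (int (c div d) * j))"
  proof (rule sum.reindex_bij_witness[where j = "\<lambda>j. (c div g j, j div int (g j))" and i = "\<lambda>(d,j). int (c div d) * j"])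
    fix j assume j: "j \<in> {0..<int c}"
    have jg: "j = int (g j) * (j div int (g j))" by (simp add: g)
    then show "(case (c div g j, j div int (g j)) of (d, j) \<Rightarrow> int (c div d) * j) = j"
      by (simp add: cc)
    then show "(case (c div g j, j div int (g j)) of (d, j) \<Rightarrow> h (int (c div d) * j)) = h j" by simp
    have "coprime (j div int (g j)) (int (c div g j))"
      using div_gcd_coprime[of j "int c"] c by (simp add: g zdiv_int)
    moreover have "int (g j) * (j div int (g j)) < int (g j) * int (c div g j)"
      using j jg gdvd[of j] by (simp flip: of_nat_mult)
    then have "j div int (g j) < int (c div g j)"
      using g0[of j] by (simp only: mult_less_cancel_left_pos of_nat_0_less_iff)
    moreover have "0 \<le> j div int (g j)" using j by (simp add: pos_imp_zdiv_nonneg_iff g0)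
    ultimately show "(c div g j, j div int (g j)) \<in> (SIGMA d:{d. d dvd c}. coprime_residues d)"
      using gdvd[of j] by (auto simp: coprime_residues_def div_dvd_iff_mult)
  next
    fix x assume "x \<in> (SIGMA d:{d. d dvd c}. coprime_residues d)"
    then obtain d j where x: "x = (d, j)" "d dvd c" "0 \<le> j" "j < int d" "coprime j (int d)"
      by (auto simp: coprime_residues_def)
    note p = pos[OF x(2)]
    have "gcd (int (c div d) * j) (int c) = int (c div d) * gcd j (int d)"
      using p(3) gcd_mult_distrib_int[of "int (c div d)" j "int d"] by simp
    then have gg: "g (int (c div d) * j) = c div d" using x(5) by (simp add: g_def coprime_iff_gcd_eq_1)
    show "(c div g (case x of (d, j) \<Rightarrow> int (c div d) * j),
        (case x of (d, j) \<Rightarrow> int (c div d) * j) div int (g (case x of (d, j) \<Rightarrow> int (c div d) * j))) = x"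
      using p(2) x(2) c by (simp add: x(1) gg div_div_eq_right)
    have "int (c div d) * j < int (c div d) * int d" using x(4) p(2) by simp
    then show "(case x of (d, j) \<Rightarrow> int (c div d) * j) \<in> {0..<int c}"
      using x(3) p by (simp add: x(1))
  qed
  then show ?thesis using c by (simp add: sum.Sigma)
qed

text \<open>A Ramanujan-type sum at frequency \<open>l\<close>. The modulus of \<open>chi\<close>
  may be a proper divisor of \<open>d\<close>; restricting to units modulo \<open>d\<close> then
  removes residues at which \<open>chi\<close> is nonzero, unlike in
  \<open>gauss_sum\<close>.\<close>

definition gauss_sum_at :: "nat \<Rightarrow> (int \<Rightarrow> complex) \<Rightarrow> int \<Rightarrow> complex" where
  "gauss_sum_at d chi l = (\<Sum>a\<in>coprime_residues d. chi a * ee d (l * a))"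

lemma gauss_sum_at_mult:
  assumes chi: "dirichlet_character Q chi" and Q: "Q dvd d" and d: "d > 0" and u: "coprime u (int d)"
  shows "gauss_sum_at d chi (u * l) = cnj (chi u) * gauss_sum_at d chi l"
proof -
  have uQ: "coprime u (int Q)" using u Q by (meson coprime_divisors dvd_refl of_nat_dvd_iff)
  have "(\<Sum>a\<in>coprime_residues d. chi (u * a) * ee d (l * (u * a))) = gauss_sum_at d chi l"
    unfolding gauss_sum_at_def
  proof (rule sum_coprime_residues_mult[OF d u])
    fix m n assume mn: "[m = n] (mod int d)"
    then have "[m = n] (mod int Q)" using Q by (meson cong_dvd_modulus of_nat_dvd_iff)
    then show "chi m * ee d (l * m) = chi n * ee d (l * n)"
      using dirichlet_character_cong[OF chi] ee_cong[OF d cong_mult[OF cong_refl mn]] by metis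
  qed
  then have "chi u * gauss_sum_at d chi (u * l) = gauss_sum_at d chi l"
    by (simp add: gauss_sum_at_def char_mult[OF chi] sum_distrib_left mult_ac)
  then show ?thesis using cnj_char_mult[OF chi uQ] by (metis mult.assoc mult_1)
qed

text \<open>Moebius inversion gives complete sums modulo \<open>d div k\<close>. With
  \<open>D = d div Q\<close>, a divisor \<open>k\<close> of \<open>d\<close> that does not divide
  \<open>D\<close> shares a factor with \<open>Q\<close>, so \<open>chi k = 0\<close>; for the
  others \<open>primitive_fourier_multiple\<close> applies with the complementary divisor
  \<open>t = D div k\<close>, which becomes the summation variable as in
  \<open>g_factor\<close>.\<close>

lemma gauss_sum_at_primitive:
  assumes prim: "primitive_character Q chi" and Q: "Q dvd d" and d: "d > 0"
  shows "gauss_sum_at d chi l = (\<Sum>t | t dvd d div Q. gauss_sum Q chi *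
    (of_int (moebius_mu (d div (t * Q))) * chi (int (d div (t * Q)))) *
    (if int t dvd l then of_nat t * cnj (chi (l div int t)) else 0))"
proof -
  have chi: "dirichlet_character Q chi" using prim by (simp add: primitive_character_def)
  define D where "D = d div Q"
  have dD: "d = Q * D" using Q by (simp add: D_def)
  have Dt: "d div (t * Q) = D div t" for t
    unfolding D_def by (simp add: div_mult2_eq[symmetric] mult.commute)
  have Q0: "Q > 0" and D0: "D > 0" using d by (auto simp: dD)
  define E where "E t = (if int t dvd l then of_nat t * cnj (chi (l div int t)) else 0)" for t
  define H where "H k = of_int (moebius_mu k) * chi (int k) *
      (\<Sum>i\<in>{0..<int (d div k)}. chi i * ee (d div k) (l * i))" for k
  have "gauss_sum_at d chi l = (\<Sum>k | k dvd d. H k)"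
    unfolding gauss_sum_at_def sum_coprime_moebius[OF d]
  proof (intro sum.cong refl)
    fix k assume "k \<in> {k. k dvd d}"
    then have k: "d = d div k * k" "k > 0" using d by (auto intro: Nat.gr0I)
    have "ee d (l * (int k * i)) = ee (d div k) (l * i)" for i
      by (subst k(1)) (use ee_mult_cancel[OF k(2), of "d div k" "l * i"] in \<open>simp add: mult_ac\<close>)
    then show "of_int (moebius_mu k) * (\<Sum>i\<in>{0..<int (d div k)}. chi (int k * i) * ee d (l * (int k * i))) = H k"
      by (simp add: H_def char_mult[OF chi] sum_distrib_left mult_ac)
  qed
  also have "\<dots> = (\<Sum>k | k dvd D. H k)"
  proof (rule sum.mono_neutral_right)
    show "\<forall>k\<in>{k. k dvd d} - {k. k dvd D}. H k = 0"
    proof (intro ballI)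
      fix k assume k: "k \<in> {k. k dvd d} - {k. k dvd D}"
      then have "\<not> coprime k Q" by (auto simp: dD coprime_dvd_mult_right_iff)
      then have "chi (int k) = 0" by (simp add: char_eq_0_iff[OF chi])
      then show "H k = 0" by (simp add: H_def)
    qed
  qed (use d in \<open>auto simp: dD\<close>)
  also have "\<dots> = (\<Sum>t | t dvd D. gauss_sum Q chi *
    (of_int (moebius_mu (D div t)) * chi (int (D div t))) * E t)"
  proof (rule sum.reindex_bij_witness[where i = "\<lambda>t. D div t" and j = "\<lambda>k. D div k"])
    fix k assume "k \<in> {k. k dvd D}"
    then have k: "k dvd D" by simp
    have kk: "D div (D div k) = k" using k D0 by (simp add: div_div_eq_right)
    have "d div k = Q * (D div k)" using k by (simp add: dD div_mult_swap)
    moreover have "D div k > 0" using k D0 by (auto elim: dvdE)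
    ultimately have "H k = of_int (moebius_mu k) * chi (int k) * (gauss_sum Q chi * E (D div k))"
      unfolding H_def E_def by (simp only: primitive_fourier_multiple[OF prim]) simp
    then show "gauss_sum Q chi * (of_int (moebius_mu (D div (D div k))) * chi (int (D div (D div k)))) * E (D div k) = H k"
      by (simp add: kk)
    show "D div (D div k) = k" by (fact kk)
    show "D div k \<in> {t. t dvd D}" using k by (metis dvd_div_mult_self dvd_triv_left mem_Collect_eq)
  next
    fix k assume "k \<in> {t. t dvd D}"
    then have k: "k dvd D" by simp
    show "D div (D div k) = k" using k D0 by (simp add: div_div_eq_right)
    show "D div k \<in> {k. k dvd D}" using k by (metis dvd_div_mult_self dvd_triv_left mem_Collect_eq)
  qed
  finally show ?thesis unfolding E_def Dt by (simp only: D_def)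
qed

text \<open>Each divisor \<open>t\<close> contributes a dilation of one and the same series, with
  \<open>eta t\<close> pulled out by multiplicativity, so \<open>s\<close> factors out of the
  divisor sum. Both \<open>eta = chi1\<close> and the constant 1 are used later.\<close>

lemma Lsums_gauss_sum_at:
  assumes prim: "primitive_character Q chi" and Q: "Q dvd d" and d: "d > 0"
    and mult: "\<And>m n. eta (m * n) = eta m * eta n"
    and s: "Lsums (\<lambda>l. eta l * cnj (chi l)) s"
  shows "Lsums (\<lambda>l. eta l * gauss_sum_at d chi l)
    (gauss_sum Q chi * s * (\<Sum>t | t dvd d div Q.
       eta (int t) * of_int (moebius_mu (d div (t * Q))) * chi (int (d div (t * Q)))))"
proof -
  define w where "w t = gauss_sum Q chi * (of_int (moebius_mu (d div (t * Q))) * chi (int (d div (t * Q))))" for t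
  have "Lsums (\<lambda>l. \<Sum>t | t dvd d div Q. (w t * eta (int t)) *
      (if int t dvd l then of_nat t * (eta (l div int t) * cnj (chi (l div int t))) else 0))
      (\<Sum>t | t dvd d div Q. (w t * eta (int t)) * s)"
  proof (intro Lsums_sum Lsums_mult)
    fix t assume "t \<in> {t. t dvd d div Q}"
    then have "t > 0" using Q d by (auto intro!: Nat.gr0I)
    then show "Lsums (\<lambda>l. if int t dvd l then of_nat t * (eta (l div int t) * cnj (chi (l div int t))) else 0) s"
      using s by (rule Lsums_dilate)
  qed
  moreover have "(\<Sum>t | t dvd d div Q. (w t * eta (int t)) *
      (if int t dvd l then of_nat t * (eta (l div int t) * cnj (chi (l div int t))) else 0)) =
      eta l * gauss_sum_at d chi l" for l
    unfolding gauss_sum_at_primitive[OF prim Q d] sum_distrib_left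
  proof (intro sum.cong refl)
    fix t
    have "int t dvd l \<Longrightarrow> eta l = eta (int t) * eta (l div int t)"
      by (metis dvd_mult_div_cancel mult)
    then show "(w t * eta (int t)) *
      (if int t dvd l then of_nat t * (eta (l div int t) * cnj (chi (l div int t))) else 0) =
      eta l * (gauss_sum Q chi * (of_int (moebius_mu (d div (t * Q))) * chi (int (d div (t * Q)))) *
        (if int t dvd l then of_nat t * cnj (chi (l div int t)) else 0))"
      by (simp add: w_def mult_ac)
  qed
  ultimately show ?thesis
    by (simp add: w_def sum_distrib_left mult_ac)
qed

text \<open>Because \<open>chi\<close> is odd, pairing it with the sines of the series of
  \<open>B1\<close> gives \<open>- \<i>\<close> times its Gauss sums.
  \<open>Lsums_gauss_sum_at\<close> with \<open>eta\<close> constantly 1 sums these up, and dividing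
  by \<open>- pi\<close> produces \<open>\<i> / pi\<close>.\<close>

lemma sum_char_B1:
  assumes prim: "primitive_character Q chi" and Q: "Q dvd d" and d: "d > 0" and odd: "chi (- 1) = - 1"
  shows "(\<Sum>j\<in>coprime_residues d. chi j * of_real (B1 (of_int j / of_nat d))) =
    \<i> / of_real pi * gauss_sum Q chi * L_one (\<lambda>n. cnj (chi n)) *
      (\<Sum>k | k dvd d. of_int (moebius_mu k) * chi (int k))" (is "?B = _")
proof -
  have chi: "dirichlet_character Q chi" using prim by (simp add: primitive_character_def)
  have Q0: "Q > 0" by (rule char_modulus_pos[OF chi])
  have odd': "chi (- n) = - chi n" for n using char_mult[OF chi, of "- 1" n] odd by simp
  have "Lsums (\<lambda>n. cnj (chi n)) (L_one (\<lambda>n. cnj (chi n)))"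
    using dirichlet_character_cong[OF chi] by (intro odd_periodic_Lsums[OF Q0]) (auto simp: odd')
  then have "Lsums (\<lambda>l. 1 * cnj (chi l)) (L_one (\<lambda>n. cnj (chi n)))" by simp
  from Lsums_gauss_sum_at[OF prim Q d _ this]
  have 1: "Lsums (gauss_sum_at d chi) (gauss_sum Q chi * L_one (\<lambda>n. cnj (chi n)) *
     (\<Sum>t | t dvd d div Q. of_int (moebius_mu (d div (t * Q))) * chi (int (d div (t * Q)))))"
    by simp
  have "Lsums (\<lambda>l. \<Sum>j\<in>coprime_residues d. chi j * of_real (sin (2 * pi * of_int l * (of_int j / of_nat d))))
     (\<Sum>j\<in>coprime_residues d. chi j * (- of_real pi * of_real (B1 (of_int j / of_nat d))))"
    by (intro Lsums_sum Lsums_mult Lsums_sin)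
  moreover have "(\<Sum>j\<in>coprime_residues d. chi j * of_real (sin (2 * pi * of_int l * (of_int j / of_nat d)))) =
      - \<i> * gauss_sum_at d chi l" for l
  proof -
    have "gauss_sum_at d chi (- l) = - gauss_sum_at d chi l"
      using gauss_sum_at_mult[OF chi Q d, of "- 1" l] odd by simp
    then have "- \<i> * gauss_sum_at d chi l = - \<i> / 2 * (gauss_sum_at d chi l - gauss_sum_at d chi (- l))"
      by simp
    also have "\<dots> = (\<Sum>j\<in>coprime_residues d. chi j * (- \<i> / 2 * (ee d (l * j) - ee d (- (l * j)))))"
      by (simp add: gauss_sum_at_def sum_distrib_left ring_distribs flip: sum_subtractf) (simp add: mult_ac)
    also have "\<dots> = (\<Sum>j\<in>coprime_residues d. chi j * of_real (sin (2 * pi * of_int l * (of_int j / of_nat d))))"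
      by (intro sum.cong refl arg_cong2[of _ _ _ _ times]) (simp add: ee_minus ee_def complex_eq_iff mult.assoc)
    finally show ?thesis ..
  qed
  ultimately have "Lsums (\<lambda>l. - \<i> * gauss_sum_at d chi l) (- of_real pi * ?B)"
    by (simp add: sum_distrib_left mult_ac)
  from Lsums_unique[OF this Lsums_mult[OF 1]]
  have "of_real pi * ?B = \<i> * (gauss_sum Q chi * L_one (\<lambda>n. cnj (chi n)) *
     (\<Sum>t | t dvd d div Q. of_int (moebius_mu (d div (t * Q))) * chi (int (d div (t * Q)))))"
    by simp
  \<comment> \<open>The divisors \<open>k\<close> of \<open>d\<close> that do not divide
    \<open>d div Q\<close> share a factor with \<open>Q\<close> and contribute 0; the remaining ones
    are the complementary divisors of \<open>t\<close>.\<close>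
  moreover have "(\<Sum>t | t dvd d div Q. of_int (moebius_mu (d div (t * Q))) * chi (int (d div (t * Q)))) =
      (\<Sum>k | k dvd d. of_int (moebius_mu k) * chi (int k))"
  proof -
    define D where "D = d div Q"
    have dD: "d = Q * D" using Q by (simp add: D_def)
  have Dt: "d div (t * Q) = D div t" for t
    unfolding D_def by (simp add: div_mult2_eq[symmetric] mult.commute)
    have D0: "D > 0" using d by (auto simp: dD)
    have "(\<Sum>k | k dvd d. of_int (moebius_mu k) * chi (int k)) = (\<Sum>k | k dvd D. of_int (moebius_mu k) * chi (int k))"
    proof (rule sum.mono_neutral_right)
      show "\<forall>k\<in>{k. k dvd d} - {k. k dvd D}. of_int (moebius_mu k) * chi (int k) = 0"
        by (auto simp: dD coprime_dvd_mult_right_iff char_eq_0_iff[OF chi])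
    qed (use d in \<open>auto simp: dD\<close>)
    also have "\<dots> = (\<Sum>t | t dvd D. of_int (moebius_mu (D div t)) * chi (int (D div t)))"
      by (rule sum.reindex_bij_witness[where i = "\<lambda>t. D div t" and j = "\<lambda>k. D div k"])
        (use D0 in \<open>auto simp: div_div_eq_right div_dvd_iff_mult\<close>)
    finally show ?thesis unfolding Dt by (simp only: D_def)
  qed
  ultimately show ?thesis by (simp add: field_simps)
qed

section \<open>The transform of the Dedekind sum\<close>

text \<open>Evaluating the double sum of \<open>h (a * b)\<close> in two ways replaces a count of
  the fibres of reduction: for fixed \<open>b\<close>, a lift of \<open>b\<close> permutes the units
  modulo \<open>c\<close>; for fixed \<open>a\<close>, multiplication permutes those modulo
  \<open>d\<close>.\<close>

lemma sum_coprime_residues_reduce: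
  fixes h :: "int \<Rightarrow> complex"
  assumes c: "c > 0" and d: "d dvd c" and per: "\<And>m n. [m = n] (mod int d) \<Longrightarrow> h m = h n"
  shows "of_nat (totient d) * (\<Sum>a\<in>coprime_residues c. h a) =
    of_nat (totient c) * (\<Sum>b\<in>coprime_residues d. h b)"
proof -
  have d0: "d > 0" using c d by (auto intro: Nat.gr0I)
  have per': "\<And>m n. [m = n] (mod int c) \<Longrightarrow> h m = h n"
    using per d by (meson cong_dvd_modulus of_nat_dvd_iff)
  have "(\<Sum>b\<in>coprime_residues d. \<Sum>a\<in>coprime_residues c. h (a * b)) =
      (\<Sum>b\<in>coprime_residues d. \<Sum>a\<in>coprime_residues c. h a)"
  proof (rule sum.cong[OF refl])
    fix b assume "b \<in> coprime_residues d"
    then have "coprime b (int d)" by (simp add: coprime_residues_def)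
    then obtain u where u: "[u = b] (mod int d)" "coprime u (int c)"
      using exists_coprime_lift[OF c d] by blast
    have "h (a * b) = h (u * a)" for a
      using cong_mult[OF cong_refl u(1), of a] by (intro per) (simp add: mult.commute cong_sym)
    then show "(\<Sum>a\<in>coprime_residues c. h (a * b)) = (\<Sum>a\<in>coprime_residues c. h a)"
      using sum_coprime_residues_mult[OF c u(2) per'] by simp
  qed
  moreover have "(\<Sum>b\<in>coprime_residues d. \<Sum>a\<in>coprime_residues c. h (a * b)) =
      (\<Sum>a\<in>coprime_residues c. \<Sum>b\<in>coprime_residues d. h b)"
  proof (subst sum.swap, rule sum.cong[OF refl])
    fix a assume "a \<in> coprime_residues c"
    then have "coprime a (int d)"
      using d coprime_dvd_modulus unfolding coprime_residues_def by blast
    from sum_coprime_residues_mult[OF d0 this per]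
    show "(\<Sum>b\<in>coprime_residues d. h (a * b)) = (\<Sum>b\<in>coprime_residues d. h b)" .
  qed
  ultimately show ?thesis by (simp only: sum_constant card_coprime_residues[OF c] card_coprime_residues[OF d0])
qed

lemma prim_char_eq:
  assumes "dirichlet_character q chi" "coprime n (int q)"
  shows "prim_char q chi n = chi n"
  using prim_char_inducing(2)[OF assms(1)] assms(2) by (simp add: induced_from_def)

lemma dirichlet_character_prim_char:
  assumes "dirichlet_character q chi"
  shows "dirichlet_character (conductor q chi) (prim_char q chi)" "conductor q chi dvd q"
  using prim_char_inducing(2)[OF assms] by (simp_all add: induced_from_def)

lemma char_cong_dvd:
  assumes "dirichlet_character r chi" "r dvd q" "[m = n] (mod int q)"
  shows "chi m = chi n"
  using dirichlet_character_cong[OF assms(1)] assms(2,3) by (meson cong_dvd_modulus of_nat_dvd_iff)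

text \<open>At such a frequency the exponential depends only on \<open>a\<close> modulo
  \<open>d\<close>. If the conductor divides \<open>d\<close>, replacing \<open>psi\<close> by its
  primitive version makes the whole summand periodic modulo \<open>d\<close>. If not, a unit
  \<open>u\<close> congruent to 1 modulo \<open>d\<close> with \<open>psi u\<close> different from 1
  forces the sum to vanish.\<close>

lemma gauss_sum_at_imprimitive:
  assumes psi: "dirichlet_character c psi" and d: "d dvd c"
  shows "gauss_sum_at c psi (int (c div d) * m) =
    (if conductor c psi dvd d
     then of_nat (totient c) / of_nat (totient d) * gauss_sum_at d (prim_char c psi) m else 0)"
proof -
  have c: "c > 0" by (rule char_modulus_pos[OF psi])
  have d0: "d > 0" and cd0: "c div d > 0" and cd: "c = d * (c div d)" using c d by (auto elim: dvdE)
  have e: "ee c (int (c div d) * m * a) = ee d (m * a)" for a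
    using ee_mult_cancel[OF cd0, of d "m * a"] cd by (simp add: mult_ac)
  have G: "gauss_sum_at c psi (int (c div d) * m) = (\<Sum>a\<in>coprime_residues c. psi a * ee d (m * a))"
    by (simp add: gauss_sum_at_def e)
  show ?thesis
  proof (cases "conductor c psi dvd d")
    case True
    have per: "prim_char c psi k * ee d (m * k) = prim_char c psi n * ee d (m * n)"
      if "[k = n] (mod int d)" for k n
      using char_cong_dvd[OF dirichlet_character_prim_char(1)[OF psi] True that]
        ee_cong[OF d0 cong_mult[OF cong_refl that]] by metis
    have "gauss_sum_at c psi (int (c div d) * m) =
        (\<Sum>a\<in>coprime_residues c. prim_char c psi a * ee d (m * a))"
      unfolding G by (intro sum.cong refl) (simp add: coprime_residues_def prim_char_eq[OF psi])
    then have "of_nat (totient d) * gauss_sum_at c psi (int (c div d) * m) =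
        of_nat (totient c) * gauss_sum_at d (prim_char c psi) m"
      using sum_coprime_residues_reduce[OF c d per] by (simp add: gauss_sum_at_def)
    then show ?thesis using True d0 by (simp add: field_simps)
  next
    case False
    then have "\<not> (\<exists>chi'. induced_from c psi d chi')" using conductor_dvd[OF psi] by blast
    then obtain u where u: "coprime u (int c)" "[u = 1] (mod int d)" "psi u \<noteq> 1"
      using induced_from_exists[OF psi d] by blast
    have "(\<Sum>a\<in>coprime_residues c. psi a * ee d (m * a)) =
        (\<Sum>a\<in>coprime_residues c. psi (u * a) * ee d (m * (u * a)))"
    proof (rule sum_coprime_residues_mult[OF c u(1), symmetric])
      fix k n assume kn: "[k = n] (mod int c)"
      then have "[k = n] (mod int d)" using d by (meson cong_dvd_modulus of_nat_dvd_iff)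
      then show "psi k * ee d (m * k) = psi n * ee d (m * n)"
        using dirichlet_character_cong[OF psi kn] ee_cong[OF d0 cong_mult[OF cong_refl]] by metis
    qed
    also have "\<dots> = psi u * (\<Sum>a\<in>coprime_residues c. psi a * ee d (m * a))"
      unfolding sum_distrib_left
    proof (rule sum.cong[OF refl])
      fix a
      have "[m * (u * a) = m * (1 * a)] (mod int d)" by (intro cong_mult cong_refl u(2))
      then have "ee d (m * (u * a)) = ee d (m * a)" using ee_cong[OF d0] by fastforce
      then show "psi (u * a) * ee d (m * (u * a)) = psi u * (psi a * ee d (m * a))"
        by (simp add: char_mult[OF psi])
    qed
    finally show ?thesis using False u(3) by (simp add: G)
  qed
qed

lemma char_minus_one:
  assumes "dirichlet_character q chi" shows "chi (- 1) = 1 \<or> chi (- 1) = - 1"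
proof -
  have "chi (- 1) * chi (- 1) = 1" using char_mult[OF assms, of "- 1" "- 1"] char_one[OF assms] by simp
  then show ?thesis using square_eq_1_iff by blast
qed

text \<open>The sine in the series of \<open>B1\<close> splits into two exponentials, whose sums
  over \<open>n\<close> are \<open>chi1 l\<close> and \<open>chi1 (- l)\<close> times the Gauss sum;
  this is where the sign \<open>chi1 (- 1)\<close> enters.\<close>

lemma twisted_B1_Lsums:
  assumes prim: "primitive_character q1 chi1" and c: "c > 0"
  shows "Lsums (\<lambda>l. gauss_sum q1 (\<lambda>n. cnj (chi1 n)) / (2 * \<i>) *
      (chi1 l * (ee c (l * m) - chi1 (- 1) * ee c (- (l * m)))))
    (- of_real pi * (\<Sum>n\<in>{0..<int q1}. cnj (chi1 n) * of_real (B1 (of_int n / of_nat q1 + of_int m / of_nat c))))"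
proof -
  have chi: "dirichlet_character q1 chi1" using prim by (simp add: primitive_character_def)
  have q1: "q1 > 0" by (rule char_modulus_pos[OF chi])
  define tau where "tau = gauss_sum q1 (\<lambda>n. cnj (chi1 n))"
  have tau: "(\<Sum>n\<in>{0..<int q1}. cnj (chi1 n) * ee q1 (l * n)) = chi1 l * tau" for l
    using primitive_fourier[OF primitive_character_cnj[OF prim]] by (simp add: tau_def)
  have "Lsums (\<lambda>l. \<Sum>n\<in>{0..<int q1}. cnj (chi1 n) *
        of_real (sin (2 * pi * of_int l * (of_int n / of_nat q1 + of_int m / of_nat c))))
      (\<Sum>n\<in>{0..<int q1}. cnj (chi1 n) *
        (- of_real pi * of_real (B1 (of_int n / of_nat q1 + of_int m / of_nat c))))"
    by (intro Lsums_sum Lsums_mult Lsums_sin)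
  moreover have "(\<Sum>n\<in>{0..<int q1}. cnj (chi1 n) *
        of_real (sin (2 * pi * of_int l * (of_int n / of_nat q1 + of_int m / of_nat c)))) =
      tau / (2 * \<i>) * (chi1 l * (ee c (l * m) - chi1 (- 1) * ee c (- (l * m))))" for l
  proof -
    have "of_real (sin (2 * pi * of_int l * (of_int n / of_nat q1 + of_int m / of_nat c))) =
        1 / (2 * \<i>) * (ee q1 (l * n) * ee c (l * m) - ee q1 ((- l) * n) * ee c (- (l * m)))" for n
    proof -
      define x where "x = 2 * pi * of_int (l * n) / of_nat q1"
      define y where "y = 2 * pi * of_int (l * m) / of_nat c"
      have xy: "2 * pi * of_int l * (of_int n / of_nat q1 + of_int m / of_nat c) = x + y"
        by (simp add: x_def y_def ring_distribs)
      have es: "ee q1 (l * n) = cis x" "ee c (l * m) = cis y" "ee q1 ((- l) * n) = cnj (cis x)"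
        "ee c (- (l * m)) = cnj (cis y)"
        using ee_minus[of q1 "l * n"] ee_minus[of c "l * m"] by (simp_all add: ee_def x_def y_def)
      have "cis x * cis y - cnj (cis x) * cnj (cis y) = 2 * \<i> * of_real (sin (x + y))"
        by (simp add: complex_eq_iff sin_add)
      then show ?thesis unfolding xy es by simp
    qed
    moreover have "(\<Sum>n\<in>I. f n * (k * (A n * B - A' n * B'))) = k * ((\<Sum>n\<in>I. f n * A n) * B - (\<Sum>n\<in>I. f n * A' n) * B')"
      for f A A' :: "int \<Rightarrow> complex" and k B B' I
      unfolding sum_distrib_right sum_subtractf[symmetric] sum_distrib_left
      by (intro sum.cong refl) (simp add: algebra_simps)
    ultimately have "(\<Sum>n\<in>{0..<int q1}. cnj (chi1 n) *
        of_real (sin (2 * pi * of_int l * (of_int n / of_nat q1 + of_int m / of_nat c)))) =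
      1 / (2 * \<i>) * ((\<Sum>n\<in>{0..<int q1}. cnj (chi1 n) * ee q1 (l * n)) * ee c (l * m) -
        (\<Sum>n\<in>{0..<int q1}. cnj (chi1 n) * ee q1 ((- l) * n)) * ee c (- (l * m)))"
      by (simp only:)
    also have "\<dots> = tau / (2 * \<i>) * (chi1 l * (ee c (l * m) - chi1 (- 1) * ee c (- (l * m))))"
      unfolding tau using char_mult[OF chi, of "- 1" l] by (simp add: field_simps)
    finally show ?thesis .
  qed
  ultimately show ?thesis by (simp add: tau_def sum_distrib_left mult_ac)
qed

text \<open>The two exponentials become Gauss sums of \<open>psi\<close> at \<open>l * j\<close> and
  \<open>- (l * j)\<close>, which differ by the factor \<open>psi (- 1)\<close>. The parity
  condition on \<open>psi\<close> comes from here.\<close>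

lemma twisted_B1_gauss_Lsums:
  assumes prim: "primitive_character q1 chi1" and psi: "dirichlet_character c psi"
  shows "Lsums (\<lambda>l. gauss_sum q1 (\<lambda>n. cnj (chi1 n)) / (2 * \<i>) * (1 - psi (- 1) * chi1 (- 1)) *
      (chi1 l * gauss_sum_at c psi (l * j)))
    (- of_real pi * (\<Sum>a\<in>coprime_residues c. psi a * (\<Sum>n\<in>{0..<int q1}.
      cnj (chi1 n) * of_real (B1 (of_int n / of_nat q1 + of_int (a * j) / of_nat c)))))"
proof -
  have c: "c > 0" by (rule char_modulus_pos[OF psi])
  define tau where "tau = gauss_sum q1 (\<lambda>n. cnj (chi1 n)) / (2 * \<i>)"
  define F where "F m = (\<Sum>n\<in>{0..<int q1}. cnj (chi1 n) * complex_of_real (B1 (of_int n / of_nat q1 + of_int m / of_nat c)))" for m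
  have "Lsums (\<lambda>l. \<Sum>a\<in>coprime_residues c. psi a * (tau * (chi1 l *
        (ee c (l * (a * j)) - chi1 (- 1) * ee c (- (l * (a * j)))))))
      (\<Sum>a\<in>coprime_residues c. psi a * (- of_real pi * F (a * j)))"
    unfolding tau_def F_def by (intro Lsums_sum Lsums_mult twisted_B1_Lsums prim c)
  moreover have "(\<Sum>a\<in>coprime_residues c. psi a * (tau * (chi1 l *
        (ee c (l * (a * j)) - chi1 (- 1) * ee c (- (l * (a * j))))))) =
      tau * (1 - psi (- 1) * chi1 (- 1)) * (chi1 l * gauss_sum_at c psi (l * j))" for l
  proof -
    have "cnj (psi (- 1)) = psi (- 1)" using char_minus_one[OF psi] by auto
    then have neg: "gauss_sum_at c psi (- (l * j)) = psi (- 1) * gauss_sum_at c psi (l * j)"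
      using gauss_sum_at_mult[OF psi dvd_refl c, of "- 1" "l * j"] by simp
    have lin: "(\<Sum>n\<in>I. f n * (k * (z * (A n - x * A' n)))) = k * (z * ((\<Sum>n\<in>I. f n * A n) - x * (\<Sum>n\<in>I. f n * A' n)))"
      for f A A' :: "int \<Rightarrow> complex" and k z x I
      unfolding sum_distrib_left sum_subtractf[symmetric] by (intro sum.cong refl) (simp add: algebra_simps)
    have G: "(\<Sum>a\<in>coprime_residues c. psi a * ee c (l * (a * j))) = gauss_sum_at c psi (l * j)"
      "(\<Sum>a\<in>coprime_residues c. psi a * ee c (- (l * (a * j)))) = gauss_sum_at c psi (- (l * j))"
      by (simp_all add: gauss_sum_at_def mult_ac)
    show ?thesis unfolding lin G neg by (simp add: algebra_simps)
  qed
  moreover have "(\<Sum>a\<in>coprime_residues c. psi a * (- of_real pi * F (a * j))) =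
      - of_real pi * (\<Sum>a\<in>coprime_residues c. psi a * F (a * j))"
    by (simp only: sum_distrib_left mult.left_commute)
  ultimately show ?thesis by (simp only: tau_def F_def)
qed

lemma dedekind_sum_transform:
  "(\<Sum>a\<in>coprime_residues c. psi a * dedekind_sum q1 chi1 chi2 a c) =
    (\<Sum>j\<in>{0..<int c}. cnj (chi2 j) * of_real (B1 (of_int j / of_nat c)) *
      (\<Sum>a\<in>coprime_residues c. psi a * (\<Sum>n\<in>{0..<int q1}.
        cnj (chi1 n) * of_real (B1 (of_int n / of_nat q1 + of_int (a * j) / of_nat c)))))"
proof -
  have "psi a * dedekind_sum q1 chi1 chi2 a c = (\<Sum>j\<in>{0..<int c}. cnj (chi2 j) * of_real (B1 (of_int j / of_nat c)) *
      (psi a * (\<Sum>n\<in>{0..<int q1}.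
        cnj (chi1 n) * of_real (B1 (of_int n / of_nat q1 + of_int (a * j) / of_nat c)))))" for a
    unfolding dedekind_sum_def sum_distrib_left by (intro sum.cong refl) (simp only: mult_ac)
  then have "(\<Sum>a\<in>coprime_residues c. psi a * dedekind_sum q1 chi1 chi2 a c) =
    (\<Sum>j\<in>{0..<int c}. \<Sum>a\<in>coprime_residues c. cnj (chi2 j) * of_real (B1 (of_int j / of_nat c)) *
      (psi a * (\<Sum>n\<in>{0..<int q1}.
        cnj (chi1 n) * of_real (B1 (of_int n / of_nat q1 + of_int (a * j) / of_nat c)))))"
    by (simp only:) (rule sum.swap)
  then show ?thesis by (simp only: sum_distrib_left)
qed

lemma dedekind_sum_transform_even:
  assumes prim: "primitive_character q1 chi1" and psi: "dirichlet_character c psi"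
    and even: "psi (- 1) * chi1 (- 1) = 1"
  shows "(\<Sum>a\<in>coprime_residues c. psi a * dedekind_sum q1 chi1 chi2 a c) = 0"
proof -
  have "Lsums (\<lambda>l. 0) 0" by (simp add: Lsums_def)
  then have "(\<Sum>a\<in>coprime_residues c. psi a * (\<Sum>n\<in>{0..<int q1}.
      cnj (chi1 n) * of_real (B1 (of_int n / of_nat q1 + of_int (a * j) / of_nat c)))) = 0" for j
    using Lsums_unique[OF twisted_B1_gauss_Lsums[OF prim psi, of j], of 0] by (simp add: even)
  then show ?thesis
    by (simp only: dedekind_sum_transform mult_zero_right sum.neutral_const)
qed

text \<open>By definition the two sides agree on units modulo \<open>c\<close>, but the sum over
  \<open>j\<close> runs over units modulo \<open>d\<close>. Both sides have period \<open>d\<close>,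
  so lifting to a unit modulo \<open>c\<close> carries the equality over.\<close>

lemma prim_char_mult_eq:
  assumes psi: "dirichlet_character c psi" and chi: "dirichlet_character q chi"
    and d: "d dvd c" "q dvd d" "conductor c psi dvd d"
  shows "conductor c (\<lambda>n. psi n * chi n) dvd d"
    and "coprime n (int d) \<Longrightarrow> prim_char c (\<lambda>n. psi n * chi n) n = prim_char c psi n * chi n"
proof -
  have c: "c > 0" by (rule char_modulus_pos[OF psi])
  have d0: "d > 0" using c d(1) by (auto intro: Nat.gr0I)
  define theta where "theta = (\<lambda>n. psi n * chi n)"
  \<comment> \<open>Without the principal factor the product may be nonzero at integers not coprime
    to \<open>d\<close> and so fail to be a character modulo \<open>d\<close>.\<close>
  define eta where "eta = (\<lambda>n. principal_character d n * prim_char c psi n * chi n)"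
  have theta: "dirichlet_character c theta"
    unfolding theta_def using dirichlet_character_mult[OF psi chi] d dvd_trans by blast
  have "dirichlet_character d eta"
    unfolding eta_def
    by (rule dirichlet_character_mult[OF dirichlet_character_mult[OF dirichlet_character_principal[OF d0]
      dirichlet_character_prim_char(1)[OF psi] d(3)] chi d(2)])
  moreover have "theta n = eta n" if "coprime n (int c)" for n
    using coprime_dvd_modulus[OF that d(1)] prim_char_eq[OF psi that]
    by (simp add: theta_def eta_def principal_character_def)
  ultimately have ind: "induced_from c theta d eta" using d(1) by (simp add: induced_from_def)
  then have cond: "conductor c theta dvd d" by (rule conductor_dvd[OF theta])
  then show "conductor c (\<lambda>n. psi n * chi n) dvd d" by (simp only: theta_def)
  assume n: "coprime n (int d)"
  obtain m where m: "[m = n] (mod int d)" "coprime m (int c)"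
    using exists_coprime_lift[OF c d(1) n] by blast
  have "prim_char c theta n = prim_char c theta m"
    by (rule char_cong_dvd[OF dirichlet_character_prim_char(1)[OF theta] cond cong_sym[OF m(1)]])
  also have "\<dots> = prim_char c psi m * chi m"
    using prim_char_eq[OF theta m(2)] prim_char_eq[OF psi m(2)] by (simp add: theta_def)
  also have "\<dots> = prim_char c psi n * chi n"
    using char_cong_dvd[OF dirichlet_character_prim_char(1)[OF psi] d(3) m(1)]
      char_cong_dvd[OF chi d(2) m(1)] by simp
  finally show "prim_char c (\<lambda>n. psi n * chi n) n = prim_char c psi n * chi n" by (simp only: theta_def)
qed

text \<open>For \<open>j\<close> in the class of \<open>d\<close>, the inner sum \<open>W\<close>
  depends on \<open>j\<close> only through the conjugate of \<open>psi' j\<close>, so the outer sum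
  is the \<open>B1\<close> sum of an odd primitive character. Each step contributes
  \<open>\<i> / pi\<close>, hence \<open>- 1 / pi\<^sup>2\<close>.\<close>

lemma dedekind_sum_transform_odd:
  assumes prim1: "primitive_character q1 chi1" and prim2: "primitive_character q2 chi2"
    and psi: "dirichlet_character c psi" and q: "q1 dvd c" "q2 dvd c"
    and parity: "chi1 (- 1) * chi2 (- 1) = 1" and odd: "psi (- 1) * chi1 (- 1) = - 1"
  shows "(\<Sum>a\<in>coprime_residues c. psi a * dedekind_sum q1 chi1 chi2 a c) =
    - of_nat (totient c) / of_real (pi\<^sup>2) * L_one (\<lambda>n. cnj (prim_char c psi n) * chi1 n) *
      L_one (prim_char c (\<lambda>n. psi n * chi2 n)) * g_factor q1 chi1 chi2 psi c"
proof -
  have chi1: "dirichlet_character q1 chi1" and chi2: "dirichlet_character q2 chi2"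
    using prim1 prim2 by (simp_all add: primitive_character_def)
  have c: "c > 0" by (rule char_modulus_pos[OF psi])
  define theta where "theta = (\<lambda>n. psi n * chi2 n)"
  have theta: "dirichlet_character c theta"
    unfolding theta_def by (rule dirichlet_character_mult[OF psi chi2 q(2)])
  define psi' where "psi' = prim_char c psi"
  define Q where "Q = conductor c psi"
  define theta' where "theta' = (\<lambda>n. cnj (prim_char c theta n))"
  define r where "r = conductor c theta"
  have psi'_prim: "primitive_character Q psi'" and Qc: "Q dvd c"
    using prim_char_inducing[OF psi] by (simp_all add: psi'_def Q_def induced_from_def)
  then have psi': "dirichlet_character Q psi'" by (simp add: primitive_character_def)
  have theta'_prim: "primitive_character r theta'"
    unfolding theta'_def r_def by (rule primitive_character_cnj[OF prim_char_inducing(1)[OF theta]])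
  have one: "coprime (- 1) (int c)" by simp
  have psi'_neg: "psi' (- 1) = psi (- 1)" unfolding psi'_def by (rule prim_char_eq[OF psi one])
  \<comment> \<open>Multiplying the two parity hypotheses shows that \<open>psi * chi2\<close> is
    odd, as \<open>sum_char_B1\<close> demands.\<close>
  have theta'_neg: "theta' (- 1) = - 1"
  proof -
    have "theta (- 1) = - 1"
      using char_minus_one[OF psi] char_minus_one[OF chi1] char_minus_one[OF chi2] parity odd
      unfolding theta_def by auto
    then show ?thesis unfolding theta'_def prim_char_eq[OF theta one] by simp
  qed
  define tau1 where "tau1 = gauss_sum q1 (\<lambda>n. cnj (chi1 n))"
  define L1 where "L1 = L_one (\<lambda>n. cnj (psi' n) * chi1 n)"
  define L2 where "L2 = L_one (\<lambda>n. cnj (theta' n))"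
  define M where "M d = (\<Sum>t | t dvd d div Q. chi1 (int t) * of_int (moebius_mu (d div (t * Q))) *
    psi' (int (d div (t * Q))))" for d
  define N where "N d = (\<Sum>k | k dvd d. of_int (moebius_mu k) * theta' (int k))" for d
  define W where "W j = (\<Sum>a\<in>coprime_residues c. psi a * (\<Sum>n\<in>{0..<int q1}.
    cnj (chi1 n) * complex_of_real (B1 (of_int n / of_nat q1 + of_int (a * j) / of_nat c))))" for j
  have L1: "Lsums (\<lambda>l. chi1 l * cnj (psi' l)) L1"
  proof -
    have "Lsums (\<lambda>n. cnj (psi' n) * chi1 n) L1" unfolding L1_def
    proof (rule odd_periodic_Lsums[OF c])
      show "cnj (psi' m) * chi1 m = cnj (psi' n) * chi1 n" if "[m = n] (mod int c)" for m n
        using char_cong_dvd[OF psi' Qc that] char_cong_dvd[OF chi1 q(1) that] by simp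
      have "cnj (psi' (- 1)) * chi1 (- 1) = - 1"
        unfolding psi'_neg using char_minus_one[OF psi] char_minus_one[OF chi1] odd by auto
      then show "cnj (psi' (- n)) * chi1 (- n) = - (cnj (psi' n) * chi1 n)" for n
        using char_mult[OF psi', of "- 1" n] char_mult[OF chi1, of "- 1" n]
        by (simp add: mult_ac)
    qed
    then show ?thesis by (simp only: mult.commute)
  qed
  have W: "W (int (c div d) * j) = (if Q dvd d then \<i> / of_real pi * tau1 * gauss_sum Q psi' * L1 *
      (of_nat (totient c) / of_nat (totient d)) * M d * cnj (psi' j) else 0)"
    if d: "d dvd c" and j: "j \<in> coprime_residues d" for d j
  proof -
    have d0: "d > 0" using c d by (auto intro: Nat.gr0I)
    have W1: "Lsums (\<lambda>l. tau1 / (2 * \<i>) * (1 - psi (- 1) * chi1 (- 1)) *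
      (chi1 l * gauss_sum_at c psi (l * (int (c div d) * j)))) (- of_real pi * W (int (c div d) * j))"
      unfolding tau1_def W_def by (rule twisted_B1_gauss_Lsums[OF prim1 psi])
    have G: "gauss_sum_at c psi (l * (int (c div d) * j)) =
      (if Q dvd d then of_nat (totient c) / of_nat (totient d) * (cnj (psi' j) * gauss_sum_at d psi' l) else 0)" for l
    proof -
      have "gauss_sum_at c psi (l * (int (c div d) * j)) = gauss_sum_at c psi (int (c div d) * (j * l))"
        by (simp only: mult_ac)
      also have "\<dots> = (if Q dvd d then of_nat (totient c) / of_nat (totient d) * gauss_sum_at d psi' (j * l) else 0)"
        unfolding Q_def psi'_def by (rule gauss_sum_at_imprimitive[OF psi d])
      finally show ?thesis
        using gauss_sum_at_mult[OF psi' _ d0] j by (simp add: coprime_residues_def)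
    qed
    show ?thesis
    proof (cases "Q dvd d")
      case True
      \<comment> \<open>Here \<open>1 - psi (- 1) * chi1 (- 1) = 2\<close>, which cancels the 2 in
        \<open>2 * \<i>\<close>.\<close>
      define w where "w = tau1 / \<i> * (of_nat (totient c) / of_nat (totient d)) * cnj (psi' j)"
      have "Lsums (\<lambda>l. w * (chi1 l * gauss_sum_at d psi' l)) (w * (gauss_sum Q psi' * L1 * M d))"
        unfolding M_def
        by (intro Lsums_mult Lsums_gauss_sum_at[OF psi'_prim True d0 char_mult[OF chi1] L1])
      moreover have "tau1 / (2 * \<i>) * (1 - psi (- 1) * chi1 (- 1)) *
          (chi1 l * gauss_sum_at c psi (l * (int (c div d) * j))) = w * (chi1 l * gauss_sum_at d psi' l)" for l
        unfolding G odd using True by (simp add: w_def field_simps)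
      ultimately have eq: "- of_real pi * W (int (c div d) * j) = w * (gauss_sum Q psi' * L1 * M d)"
        using Lsums_unique W1 by simp
      have "W (int (c div d) * j) = - (- of_real pi * W (int (c div d) * j)) / of_real pi" by simp
      also have "\<dots> = - (w * (gauss_sum Q psi' * L1 * M d)) / of_real pi" by (simp only: eq)
      finally show ?thesis using True by (simp add: w_def mult_ac)
    next
      case False
      have "Lsums (\<lambda>l. 0) 0" by (simp add: Lsums_def)
      then show ?thesis using Lsums_unique[OF W1, of 0] False by (simp add: G)
    qed
  qed
  \<comment> \<open>The factor \<open>chi2 (c div d)\<close> stays on both sides because the sums
    are compared only where it is nonzero; there \<open>c div d\<close> is coprime to
    \<open>q2\<close>, so \<open>q2\<close> divides \<open>d\<close> and
    \<open>prim_char_mult_eq\<close> applies.\<close>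
  have B: "cnj (chi2 (int (c div d))) * (\<Sum>j\<in>coprime_residues d. cnj (chi2 j) * cnj (psi' j) * of_real (B1 (of_int j / of_nat d))) =
      cnj (chi2 (int (c div d))) * (\<i> / of_real pi * gauss_sum r theta' * L2 * N d)"
    if d: "d dvd c" "Q dvd d" for d
  proof (cases "chi2 (int (c div d)) = 0")
    case False
    have d0: "d > 0" using c d by (auto intro: Nat.gr0I)
    have "coprime (c div d) q2" using False by (simp add: char_eq_0_iff[OF chi2])
    moreover have "q2 dvd c div d * d" using d q(2) by simp
    ultimately have q2d: "q2 dvd d" by (simp add: coprime_dvd_mult_right_iff coprime_commute)
    note pm = prim_char_mult_eq[OF psi chi2 d(1) q2d d(2)[unfolded Q_def]]
    have "(\<Sum>j\<in>coprime_residues d. cnj (chi2 j) * cnj (psi' j) * of_real (B1 (of_int j / of_nat d))) =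
        (\<Sum>j\<in>coprime_residues d. theta' j * of_real (B1 (of_int j / of_nat d)))"
      by (intro sum.cong refl) (simp add: coprime_residues_def theta'_def theta_def psi'_def pm(2))
    also have "\<dots> = \<i> / of_real pi * gauss_sum r theta' * L2 * N d"
      unfolding L2_def N_def
      by (rule sum_char_B1[OF theta'_prim _ d0 theta'_neg]) (use pm(1) in \<open>simp add: r_def theta_def\<close>)
    finally show ?thesis by simp
  qed simp
  define K where "K = \<i> / of_real pi * tau1 * gauss_sum Q psi' * L1 * of_nat (totient c)"
  have "(\<Sum>a\<in>coprime_residues c. psi a * dedekind_sum q1 chi1 chi2 a c) =
      (\<Sum>j\<in>{0..<int c}. cnj (chi2 j) * of_real (B1 (of_int j / of_nat c)) * W j)"
    unfolding W_def by (rule dedekind_sum_transform)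
  also have "\<dots> = (\<Sum>d | d dvd c. \<Sum>j\<in>coprime_residues d. cnj (chi2 (int (c div d) * j)) *
      of_real (B1 (of_int (int (c div d) * j) / of_nat c)) * W (int (c div d) * j))"
    by (rule sum_residues_by_gcd[OF c])
  also have "\<dots> = (\<Sum>d | d dvd c. if Q dvd d then K * (\<i> / of_real pi * gauss_sum r theta' * L2) *
      (cnj (chi2 (int (c div d))) / of_nat (totient d) * N d * M d) else 0)"
  proof (rule sum.cong[OF refl])
    fix d assume "d \<in> {d. d dvd c}"
    then have d: "d dvd c" by simp
    have d0: "d > 0" and cd0: "c div d > 0" and cd: "c = c div d * d" using c d by (auto elim: dvdE)
    have arg: "of_int (int (c div d) * j) / of_nat c = (of_int j / of_nat d :: real)" for j
      by (subst (2) cd) (use cd0 in simp)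
    show "(\<Sum>j\<in>coprime_residues d. cnj (chi2 (int (c div d) * j)) *
      of_real (B1 (of_int (int (c div d) * j) / of_nat c)) * W (int (c div d) * j)) =
      (if Q dvd d then K * (\<i> / of_real pi * gauss_sum r theta' * L2) *
      (cnj (chi2 (int (c div d))) / of_nat (totient d) * N d * M d) else 0)"
    proof (cases "Q dvd d")
      case True
      have "(\<Sum>j\<in>coprime_residues d. cnj (chi2 (int (c div d) * j)) *
        of_real (B1 (of_int (int (c div d) * j) / of_nat c)) * W (int (c div d) * j)) =
        K / of_nat (totient d) * M d * (cnj (chi2 (int (c div d))) *
          (\<Sum>j\<in>coprime_residues d. cnj (chi2 j) * cnj (psi' j) * of_real (B1 (of_int j / of_nat d))))"
        unfolding arg sum_distrib_left
        by (intro sum.cong refl, simp only: W[OF d] True if_True K_def char_mult[OF chi2] complex_cnj_mult)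
          (simp add: mult_ac)
      then show ?thesis using True unfolding B[OF d True] by (simp add: mult_ac)
    next
      case False
      then show ?thesis by (simp add: W[OF d])
    qed
  qed
  also have "\<dots> = (\<Sum>d | d dvd c \<and> Q dvd d. K * (\<i> / of_real pi * gauss_sum r theta' * L2) *
      (cnj (chi2 (int (c div d))) / of_nat (totient d) * N d * M d))"
    using c sum.inter_filter[of "{d. d dvd c}" "\<lambda>d. K * (\<i> / of_real pi * gauss_sum r theta' * L2) *
      (cnj (chi2 (int (c div d))) / of_nat (totient d) * N d * M d)" "\<lambda>d. Q dvd d"]
    by (simp only: mem_Collect_eq finite_divisors_nat)
  also have "\<dots> = K * (\<i> / of_real pi * gauss_sum r theta' * L2) *
    (\<Sum>d | d dvd c \<and> Q dvd d. cnj (chi2 (int (c div d))) / of_nat (totient d) * N d * M d)"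
    by (simp only: sum_distrib_left)
  also have "\<dots> = - of_nat (totient c) / of_real (pi\<^sup>2) * L1 * L2 * (gauss_sum r theta' * gauss_sum Q psi' * tau1 *
    (\<Sum>d | d dvd c \<and> Q dvd d. cnj (chi2 (int (c div d))) / of_nat (totient d) * N d * M d))"
    by (simp add: K_def power2_eq_square mult_ac)
  also have "gauss_sum r theta' * gauss_sum Q psi' * tau1 *
    (\<Sum>d | d dvd c \<and> Q dvd d. cnj (chi2 (int (c div d))) / of_nat (totient d) * N d * M d) =
    g_factor q1 chi1 chi2 psi c"
    unfolding g_factor_def Let_def r_def theta'_def theta_def Q_def psi'_def tau1_def N_def M_def ..
  finally show ?thesis by (simp add: L1_def L2_def theta'_def theta_def psi'_def)
qed

theorem theorem1p1:
  fixes chi1 chi2 :: "int \<Rightarrow> complex" and q1 q2 c :: nat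
  assumes "primitive_character q1 chi1" "chi1 \<noteq> principal_character q1"
    and "primitive_character q2 chi2" "chi2 \<noteq> principal_character q2"
    and "chi1 (- 1) * chi2 (- 1) = 1"
    and "c > 0" "q1 * q2 dvd c"
  shows "(\<Sum>a | a \<in> {0..<int c} \<and> coprime a (int c). (cmod (dedekind_sum q1 chi1 chi2 a c))\<^sup>2) =
    real (totient c) / pi ^ 4 *
      (\<Sum>\<psi> | dirichlet_character c \<psi> \<and> \<psi> (- 1) * chi1 (- 1) = - 1.
         (cmod (L_one (\<lambda>n. cnj (prim_char c \<psi> n) * chi1 n)))\<^sup>2 *
         (cmod (L_one (prim_char c (\<lambda>n. \<psi> n * chi2 n))))\<^sup>2 *
         (cmod (g_factor q1 chi1 chi2 \<psi> c))\<^sup>2)"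
proof -
  let ?X = "{\<psi>. dirichlet_character c \<psi>}"
  let ?S = "\<lambda>a. dedekind_sum q1 chi1 chi2 a c"
  define R where "R \<psi> = (cmod (L_one (\<lambda>n. cnj (prim_char c \<psi> n) * chi1 n)))\<^sup>2 *
         (cmod (L_one (prim_char c (\<lambda>n. \<psi> n * chi2 n))))\<^sup>2 *
         (cmod (g_factor q1 chi1 chi2 \<psi> c))\<^sup>2" for \<psi>
  have q: "q1 dvd c" "q2 dvd c" using assms(7) by (metis dvd_mult_left dvd_mult_right)+
  have chi1: "dirichlet_character q1 chi1" using assms(1) by (simp add: primitive_character_def)
  have 1: "(cmod (\<Sum>a\<in>coprime_residues c. \<psi> a * ?S a))\<^sup>2 =
      (if \<psi> (- 1) * chi1 (- 1) = - 1 then (real (totient c))\<^sup>2 / pi ^ 4 * R \<psi> else 0)"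
    if "\<psi> \<in> ?X" for \<psi>
  proof -
    have psi: "dirichlet_character c \<psi>" using that by simp
    show ?thesis
    proof (cases "\<psi> (- 1) * chi1 (- 1) = - 1")
      case True
      then show ?thesis
        unfolding dedekind_sum_transform_odd[OF assms(1,3) psi q assms(5) True]
        by (simp add: R_def norm_mult norm_divide norm_power power_mult_distrib power_divide mult_ac flip: power_mult)
    next
      case False
      then have "\<psi> (- 1) * chi1 (- 1) = 1"
        using char_minus_one[OF psi] char_minus_one[OF chi1] by auto
      then show ?thesis using False dedekind_sum_transform_even[OF assms(1) psi] by simp
    qed
  qed
  have "real (totient c) * (\<Sum>a\<in>coprime_residues c. (cmod (?S a))\<^sup>2) =
      (\<Sum>\<psi>\<in>?X. (cmod (\<Sum>a\<in>coprime_residues c. \<psi> a * ?S a))\<^sup>2)"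
    by (rule parseval_characters[OF assms(6), symmetric])
  also have "\<dots> = (\<Sum>\<psi>\<in>?X. if \<psi> (- 1) * chi1 (- 1) = - 1 then (real (totient c))\<^sup>2 / pi ^ 4 * R \<psi> else 0)"
    by (rule sum.cong[OF refl 1])
  also have "\<dots> = (\<Sum>\<psi> | dirichlet_character c \<psi> \<and> \<psi> (- 1) * chi1 (- 1) = - 1.
      (real (totient c))\<^sup>2 / pi ^ 4 * R \<psi>)"
    using sum.inter_filter[OF finite_dirichlet_characters[of c], 
      of "\<lambda>\<psi>. (real (totient c))\<^sup>2 / pi ^ 4 * R \<psi>" "\<lambda>\<psi>. \<psi> (- 1) * chi1 (- 1) = - 1"]
    by (simp only: mem_Collect_eq)
  also have "\<dots> = real (totient c) * (real (totient c) / pi ^ 4 *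
      (\<Sum>\<psi> | dirichlet_character c \<psi> \<and> \<psi> (- 1) * chi1 (- 1) = - 1. R \<psi>))"
    unfolding sum_distrib_left by (intro sum.cong refl) (simp add: power2_eq_square)
  \<comment> \<open>One of the two factors \<open>totient c\<close> from the squared transforms
    cancels against the one in Parseval's identity.\<close>
  finally have "(\<Sum>a\<in>coprime_residues c. (cmod (?S a))\<^sup>2) = real (totient c) / pi ^ 4 *
      (\<Sum>\<psi> | dirichlet_character c \<psi> \<and> \<psi> (- 1) * chi1 (- 1) = - 1. R \<psi>)"
    using assms(6) by (subst (asm) mult_cancel_left) simp
  then show ?thesis by (simp only: coprime_residues_def R_def)
qed

end
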